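(* Let $d=1$, $\mu>0$ and $\lambda+\mu\geq 0$. If $a\in L^1(\mathbb{R};\mathbb{C})\cap L^\infty(\mathbb{R};\mathbb{C})$ satisfies $\|a\|_{L^1(\mathbb{R})}<2\sqrt{\lambda+2\mu}$, then $\sigma_{\mathrm p}(A_a^\ast)=\varnothing$. Moreover, the constant $2\sqrt{\lambda+2\mu}$ is optimal, that is, it cannot be replaced by any larger constant: for every $C>2\sqrt{\lambda+2\mu}$ there exists $a\in L^1(\mathbb{R};\mathbb{C})\cap L^\infty(\mathbb{R};\mathbb{C})$ with $\|a\|_{L^1(\mathbb{R})}<C$ and $\sigma_{\mathrm p}(A_a^\ast)\neq\varnothing$.
   Context: In dimension $d=1$ the Lamé operator is $-\Delta^\ast=-(\lambda+2\mu)\frac{d^2}{dx^2}$ with domain $H^2(\mathbb{R})$ (complex-valued functions). For a bounded damping $a$, the damped elastic wave operator is $$A_a^\ast=\begin{pmatrix}0&1\\ \Delta^\ast&-a\end{pmatrix},\qquad \mathcal{D}(A_a^\ast)=H^2(\mathbb{R})\times\dot H^1(\mathbb{R}),$$ where $\dot H^1$ is the homogeneous Sobolev space. The point spectrum $\sigma_{\mathrm p}(A_a^\ast)$ is the set of eigenvalues: $z\in\mathbb{C}$ is an eigenvalue of $A_a^\ast$ if there is a non-trivial $(\psi_1,\psi_2)\in\mathcal{D}(A_a^\ast)$ with $\psi_2=z\psi_1$ and $\Delta^\ast\psi_1-a\psi_2=z\psi_2$ almost everywhere. *)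

theory Defs imports "HOL-Analysis.Analysis"
begin

text \<open>
  Elements of function spaces on the real line are represented by functions
  \<^typ>\<open>real \<Rightarrow> complex\<close>; identities between them are meant almost everywhere with respect to
  Lebesgue measure.
\<close>

definition L1 :: "(real \<Rightarrow> complex) set" where
  "L1 = {f. integrable lebesgue f}"

definition L1_norm :: "(real \<Rightarrow> complex) \<Rightarrow> real" where
  "L1_norm f = (LINT x|lebesgue. norm (f x))"

definition L2 :: "(real \<Rightarrow> complex) set" where
  "L2 = {f. f \<in> borel_measurable lebesgue \<and> integrable lebesgue (\<lambda>x. (norm (f x))\<^sup>2)}"

definition Linfty :: "(real \<Rightarrow> complex) set" where
  "Linfty = {f. f \<in> borel_measurable lebesgue \<and> (\<exists>M. AE x in lebesgue. norm (f x) \<le> M)}"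

definition L1_loc :: "(real \<Rightarrow> complex) set" where
  "L1_loc = {f. \<forall>K. compact K \<longrightarrow> set_integrable lebesgue K f}"

definition test_function :: "(real \<Rightarrow> real) \<Rightarrow> bool" where
  "test_function \<phi> \<longleftrightarrow>
     (\<forall>n x. (deriv ^^ n) \<phi> differentiable at x) \<and> compact (closure {x. \<phi> x \<noteq> 0})"

text \<open>
  Real-valued test functions suffice for complex-valued \<open>f\<close>, since both sides of the identity are
  linear in \<open>\<phi>\<close>.
\<close>
definition has_weak_derivative :: "nat \<Rightarrow> (real \<Rightarrow> complex) \<Rightarrow> (real \<Rightarrow> complex) \<Rightarrow> bool" where
  "has_weak_derivative k f g \<longleftrightarrow> f \<in> L1_loc \<and> g \<in> L1_loc \<and>
     (\<forall>\<phi>. test_function \<phi> \<longrightarrow>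
        (LINT x|lebesgue. (deriv ^^ k) \<phi> x *\<^sub>R f x) = (- 1) ^ k * (LINT x|lebesgue. \<phi> x *\<^sub>R g x))"

text \<open>A representative; it is unique up to null sets whenever a weak derivative exists.\<close>
definition weak_deriv :: "nat \<Rightarrow> (real \<Rightarrow> complex) \<Rightarrow> real \<Rightarrow> complex" where
  "weak_deriv k f = (SOME g. has_weak_derivative k f g)"

definition sobolev_H :: "nat \<Rightarrow> (real \<Rightarrow> complex) set" where
  "sobolev_H k = {f \<in> L2. \<forall>j\<le>k. \<exists>g\<in>L2. has_weak_derivative j f g}"

text \<open>
  The homogeneous Sobolev space of order one, realised by locally integrable functions (constants are not
  factored out, so that equality of components is equality almost everywhere).
\<close>
definition homogeneous_H1 :: "(real \<Rightarrow> complex) set" where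
  "homogeneous_H1 = {f \<in> L1_loc. \<exists>g\<in>L2. has_weak_derivative 1 f g}"

text \<open>In dimension one \<open>\<mu> \<Delta> u + (\<lambda> + \<mu>) \<nabla> div u = (\<lambda> + 2 \<mu>) u''\<close>.\<close>
definition lame :: "real \<Rightarrow> real \<Rightarrow> (real \<Rightarrow> complex) \<Rightarrow> real \<Rightarrow> complex" where
  "lame lam mu u = (\<lambda>x. of_real (lam + 2 * mu) * weak_deriv 2 u x)"

text \<open>The damped elastic wave operator and, below, its domain.\<close>
definition dew_op :: "real \<Rightarrow> real \<Rightarrow> (real \<Rightarrow> complex) \<Rightarrow>
    (real \<Rightarrow> complex) \<times> (real \<Rightarrow> complex) \<Rightarrow> (real \<Rightarrow> complex) \<times> (real \<Rightarrow> complex)" where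
  "dew_op lam mu a = (\<lambda>(u, v). (v, \<lambda>x. lame lam mu u x - a x * v x))"

definition dew_domain :: "((real \<Rightarrow> complex) \<times> (real \<Rightarrow> complex)) set" where
  "dew_domain = sobolev_H 2 \<times> homogeneous_H1"

definition eq_ae :: "(real \<Rightarrow> complex) \<times> (real \<Rightarrow> complex) \<Rightarrow>
    (real \<Rightarrow> complex) \<times> (real \<Rightarrow> complex) \<Rightarrow> bool" where
  "eq_ae \<Psi> \<Phi> \<longleftrightarrow> (AE x in lebesgue. fst \<Psi> x = fst \<Phi> x) \<and> (AE x in lebesgue. snd \<Psi> x = snd \<Phi> x)"

definition point_spectrum :: "real \<Rightarrow> real \<Rightarrow> (real \<Rightarrow> complex) \<Rightarrow> complex set" where
  "point_spectrum lam mu a =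
     {z. \<exists>\<Psi>\<in>dew_domain. \<not> eq_ae \<Psi> (\<lambda>x. 0, \<lambda>x. 0) \<and>
           eq_ae (dew_op lam mu a \<Psi>) (\<lambda>x. z * fst \<Psi> x, \<lambda>x. z * snd \<Psi> x)}"

end

theory Submission imports Defs
begin

text \<open>
  Write \<open>c = sqrt (\<lambda> + 2 \<mu>)\<close>. An eigenfunction solves \<open>u'' - \<kappa>\<^sup>2 u = f\<close> with \<open>\<kappa> = \<plusminus>z/c\<close>, the sign chosen
  so that \<open>Re \<kappa> \<ge> 0\<close>, and \<open>f = z a u / c\<^sup>2\<close>. The functions \<open>p = u' - \<kappa> u\<close> and \<open>q = u' + \<kappa> u\<close> solve the
  first-order equations \<open>p' = f - \<kappa> p\<close> and \<open>q' = f + \<kappa> q\<close>. Being square integrable, they are small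
  somewhere near \<open>-\<infinity>\<close> and \<open>+\<infinity>\<close>, whence \<open>|p x|\<close> and \<open>|q x|\<close> are at most the integrals of \<open>|f|\<close> over
  \<open>(-\<infinity>, x)\<close> and \<open>(x, \<infinity>)\<close>. Adding up, \<open>2 |\<kappa>| sup |u| \<le> \<parallel>f\<parallel>\<^sub>1 \<le> |z| \<parallel>a\<parallel>\<^sub>1 sup |u| / c\<^sup>2\<close>, which forces
  \<open>u = 0\<close> when \<open>\<parallel>a\<parallel>\<^sub>1 < 2 c\<close>; imaginary \<open>z\<close> need no separate treatment. The case \<open>z = 0\<close> is direct.

  For optimality, \<open>u = cosh powr (-z/c)\<close> is an eigenfunction for the eigenvalue \<open>z > 0\<close> of the damping
  \<open>a = - (z + c) sech\<^sup>2\<close>, whose norm \<open>2 c + 2 z\<close> tends to \<open>2 c\<close> as \<open>z\<close> tends to \<open>0\<close>.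
\<close>

subsection \<open>Smooth functions and test functions\<close>

text \<open>The differentiability clause of \<open>test_function\<close>, separated from compactness
  of the support.\<close>

definition smooth :: "(real \<Rightarrow> real) \<Rightarrow> bool" where
  "smooth f \<longleftrightarrow> (\<forall>n x. (deriv ^^ n) f differentiable at x)"

lemma smooth_iff: "smooth f \<longleftrightarrow> (\<forall>x. f differentiable at x) \<and> smooth (deriv f)"
proof
  assume "smooth f" then show "(\<forall>x. f differentiable at x) \<and> smooth (deriv f)"
    unfolding smooth_def by (metis funpow_0 funpow_Suc_right comp_apply)
next
  assume *: "(\<forall>x. f differentiable at x) \<and> smooth (deriv f)"
  show "smooth f" unfolding smooth_def
  proof (intro allI)
    fix n x show "(deriv ^^ n) f differentiable at x"
      using * by (cases n) (auto simp: smooth_def funpow_swap1)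
  qed
qed

text \<open>A family closed under differentiation contains every iterated derivative of its members,
  so each use supplies such a family instead of formulas for n-th derivatives.\<close>

lemma smooth_coinduct:
  assumes "X f" and step: "\<And>g. X g \<Longrightarrow> \<exists>g'. X g' \<and> (\<forall>x. (g has_real_derivative g' x) (at x))"
  shows "smooth f"
proof -
  have d: "X (deriv g) \<and> (\<forall>x. g differentiable at x)" if Xg: "X g" for g
  proof -
    obtain g' where g': "X g'" "\<And>x. (g has_real_derivative g' x) (at x)" using step[OF Xg] by blast
    then have "deriv g = g'" by (auto intro!: ext DERIV_imp_deriv)
    then show ?thesis using g' real_differentiable_def by auto
  qed
  have "X ((deriv ^^ n) f)" for n by (induction n) (use assms(1) d in auto)
  then show ?thesis using d unfolding smooth_def by blast
qed

lemma smooth_has_deriv: "smooth f \<Longrightarrow> (f has_real_derivative deriv f x) (at x)"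
  by (metis smooth_iff DERIV_deriv_iff_real_differentiable)

lemma smooth_deriv: "smooth f \<Longrightarrow> smooth (deriv f)" by (metis smooth_iff)

lemma smooth_continuous_on: "smooth f \<Longrightarrow> continuous_on S f"
  by (meson smooth_has_deriv DERIV_isCont continuous_at_imp_continuous_on)

lemma smooth_antideriv:
  assumes "smooth g" "\<And>x. (f has_real_derivative g x) (at x)" shows "smooth f"
proof -
  have "deriv f = g" using assms(2) by (auto intro!: ext DERIV_imp_deriv)
  then show ?thesis using assms real_differentiable_def smooth_iff[of f] by metis
qed

lemma smooth_lincomb:
  assumes "smooth f" "smooth g" shows "smooth (\<lambda>x. f x - c * g x)"
proof (rule smooth_coinduct[where X="\<lambda>h. \<exists>f g. smooth f \<and> smooth g \<and> h = (\<lambda>x. f x - c * g x)"])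
  fix h assume "\<exists>f g. smooth f \<and> smooth g \<and> h = (\<lambda>x. f x - c * g x)"
  then obtain f g where "smooth f" "smooth g" "h = (\<lambda>x. f x - c * g x)" by auto
  then show "\<exists>g'. (\<exists>f g. smooth f \<and> smooth g \<and> g' = (\<lambda>x. f x - c * g x)) \<and> (\<forall>x. (h has_real_derivative g' x) (at x))"
    by (intro exI[of _ "\<lambda>x. deriv f x - c * deriv g x"] conjI exI[of _ "deriv f"] exI[of _ "deriv g"])
       (auto intro!: derivative_eq_intros smooth_deriv intro: smooth_has_deriv)
qed (use assms in auto)

text \<open>Products alone are not closed under differentiation; finite sums of products are, by the
  Leibniz rule, which makes them the family to use in \<open>smooth_coinduct\<close>.\<close>

inductive smooth_product_sum :: "(real \<Rightarrow> real) \<Rightarrow> bool" where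
  prod: "smooth f \<Longrightarrow> smooth g \<Longrightarrow> smooth_product_sum (\<lambda>x. f x * g x)"
| add: "smooth_product_sum f \<Longrightarrow> smooth_product_sum g \<Longrightarrow> smooth_product_sum (\<lambda>x. f x + g x)"

lemma smooth_mult:
  assumes "smooth f" "smooth g" shows "smooth (\<lambda>x. f x * g x)"
proof (rule smooth_coinduct[where X=smooth_product_sum])
  show "smooth_product_sum (\<lambda>x. f x * g x)" using assms by (rule smooth_product_sum.intros)
next
  fix h assume "smooth_product_sum h"
  then show "\<exists>h'. smooth_product_sum h' \<and> (\<forall>x. (h has_real_derivative h' x) (at x))"
  proof induction
    case (prod f g)
    have "smooth_product_sum (\<lambda>x. deriv f x * g x + f x * deriv g x)"
      using prod by (intro smooth_product_sum.intros smooth_deriv)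
    moreover have "((\<lambda>x. f x * g x) has_real_derivative (deriv f x * g x + f x * deriv g x)) (at x)" for x
      using prod by (auto intro!: derivative_eq_intros intro: smooth_has_deriv)
    ultimately show ?case by blast
  next
    case (add f g)
    then obtain f' g' where "smooth_product_sum f'" "\<And>x. (f has_real_derivative f' x) (at x)"
      "smooth_product_sum g'" "\<And>x. (g has_real_derivative g' x) (at x)" by auto
    then show ?case
      by (intro exI[of _ "\<lambda>x. f' x + g' x"]) (auto intro!: smooth_product_sum.intros derivative_intros)
  qed
qed

text \<open>The polynomial factor makes this family closed under differentiation.\<close>
definition flat :: "real poly \<Rightarrow> real \<Rightarrow> real" where
  "flat p x = (if x > 0 then poly p (1 / x) * exp (- (1 / x)) else 0)"

text \<open>The substitution y = 1/x turns the limit into the decay of p(y) exp(-y) at infinity,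
  taken monomial by monomial.\<close>

lemma flat_tendsto_0: "(flat p \<longlongrightarrow> 0) (at_right 0)"
proof -
  have "((\<lambda>y. \<Sum>i\<le>degree p. coeff p i * (y ^ i / exp y)) \<longlongrightarrow> (\<Sum>i\<le>degree p. coeff p i * 0)) at_top"
    by (intro tendsto_intros tendsto_power_div_exp_0)
  then have "((\<lambda>y. poly p y * exp (- y)) \<longlongrightarrow> 0) at_top"
    by (simp add: poly_altdef sum_distrib_right exp_minus divide_inverse mult.assoc)
  then have "((\<lambda>x. poly p (inverse x) * exp (- inverse x)) \<longlongrightarrow> 0) (at_right 0)"
    by (rule filterlim_compose[OF _ filterlim_inverse_at_top_right])
  then show ?thesis
    by (rule Lim_transform_eventually)
       (auto simp: flat_def inverse_eq_divide eventually_at_right_less eventually_mono[OF eventually_at_right_less])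
qed

text \<open>For x > 0 the chain rule produces (1/x)^2 (p - p')(1/x) exp(-1/x), so p is replaced by
  X^2 (p - p'). Only x = 0 needs a limit argument.\<close>

lemma flat_DERIV:
  "(flat p has_real_derivative flat ([:0, 0, 1:] * (p - pderiv p)) x) (at x)"
proof -
  consider "x > 0" | "x < 0" | "x = 0" by linarith
  then show ?thesis
  proof cases
    case 1
    have "((\<lambda>x. poly p (1 / x) * exp (- (1 / x))) has_real_derivative flat ([:0, 0, 1:] * (p - pderiv p)) x) (at x)"
      using 1 by (auto intro!: derivative_eq_intros DERIV_chain2[OF poly_DERIV] simp: flat_def field_simps power2_eq_square)
    then show ?thesis
      by (rule has_field_derivative_transform_within_open[where S="{0<..}"]) (use 1 in \<open>auto simp: flat_def\<close>)
  next
    case 2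
    have "((\<lambda>x. 0) has_real_derivative flat ([:0, 0, 1:] * (p - pderiv p)) x) (at x)"
      using 2 by (auto simp: flat_def)
    then show ?thesis
      by (rule has_field_derivative_transform_within_open[where S="{..<0}"]) (use 2 in \<open>auto simp: flat_def\<close>)
  next
    case 3
    \<comment> \<open>Dividing by h multiplies the polynomial by X, so the right-hand difference
      quotient is again a flat function.\<close>
    have "((\<lambda>h. flat p h / h) \<longlongrightarrow> 0) (at_right 0)"
      by (rule Lim_transform_eventually[OF flat_tendsto_0[of "[:0, 1:] * p"]])
         (auto intro!: eventually_mono[OF eventually_at_right_less] simp: flat_def)
    moreover have "((\<lambda>h. flat p h / h) \<longlongrightarrow> 0) (at_left 0)"
      by (rule Lim_transform_eventually[OF tendsto_const])
         (auto simp: flat_def eventually_at_left_field intro!: exI[of _ "-1"])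
    ultimately have "((\<lambda>h. flat p h / h) \<longlongrightarrow> 0) (at 0)" by (simp add: filterlim_split_at)
    then show ?thesis using 3 by (simp add: DERIV_def flat_def)
  qed
qed

lemma smooth_flat_affine: "smooth (\<lambda>x. flat p (c * x + d))"
proof (rule smooth_coinduct[where X="\<lambda>h. \<exists>p. h = (\<lambda>x. flat p (c * x + d))"])
  fix h assume "\<exists>p. h = (\<lambda>x. flat p (c * x + d))"
  then obtain p where h: "h = (\<lambda>x. flat p (c * x + d))" by auto
  let ?q = "smult c ([:0, 0, 1:] * (p - pderiv p))"
  have q: "flat ?q y = flat ([:0, 0, 1:] * (p - pderiv p)) y * c" for y by (simp add: flat_def)
  have "((\<lambda>x. c * x + d) has_real_derivative c) (at x)" for x
    by (auto intro!: derivative_eq_intros)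
  note DERIV_chain2[OF flat_DERIV this]
  then have "(h has_real_derivative flat ?q (c * x + d)) (at x)" for x
    unfolding h q .
  then show "\<exists>h'. (\<exists>p. h' = (\<lambda>x. flat p (c * x + d))) \<and> (\<forall>x. (h has_real_derivative h' x) (at x))"
    by blast
qed auto

text \<open>For n > 0 a smooth function vanishing outside (a, b), which tends to the indicator of
  (a, b) as n grows. The arguments n (x - a) and n (b - x) are spelled out as affine maps to fit
  \<open>smooth_flat_affine\<close>.\<close>

definition bump :: "real \<Rightarrow> real \<Rightarrow> real \<Rightarrow> real \<Rightarrow> real" where
  "bump n a b x = flat 1 (n * x + (- n * a)) * flat 1 ((- n) * x + n * b)"

lemma smooth_bump: "smooth (bump n a b)"
  unfolding bump_def[abs_def] by (intro smooth_mult smooth_flat_affine)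

lemma bump_eq:
  assumes "n > 0"
  shows "bump n a b x = (if a < x \<and> x < b then exp (- (1 / (n * (x - a)))) * exp (- (1 / (n * (b - x)))) else 0)"
proof -
  have "n * x + (- n * a) = n * (x - a)" "(- n) * x + n * b = n * (b - x)" by algebra+
  then show ?thesis using assms by (simp only: bump_def flat_def) (simp add: zero_less_mult_iff)
qed

lemma bump_bounds:
  assumes "n > 0" shows "0 \<le> bump n a b x" "bump n a b x \<le> indicator {a<..<b} x"
  using assms by (auto simp: bump_eq intro!: mult_le_one)

lemma bump_tendsto:
  "(\<lambda>n. bump (real (Suc n)) a b x) \<longlonglongrightarrow> indicator {a<..<b} x"
proof (cases "a < x \<and> x < b")
  case True
  have *: "(\<lambda>n. exp (- (1 / (real (Suc n) * c)))) \<longlonglongrightarrow> 1" if "c > 0" for c :: real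
  proof -
    have "(\<lambda>n. exp (- (inverse (real (Suc n)) / c))) \<longlonglongrightarrow> exp (- (0 / c))"
      using that by (intro tendsto_intros LIMSEQ_inverse_real_of_nat) auto
    then show ?thesis by (simp add: field_simps)
  qed
  show ?thesis using True tendsto_mult[OF *[of "x - a"] *[of "b - x"]] by (simp add: bump_eq)
next
  case False
  then have "bump (real (Suc n)) a b x = 0" for n by (subst bump_eq) auto
  then show ?thesis using False by simp
qed

section \<open>Compactly supported smooth functions\<close>

lemma test_functionI:
  assumes "smooth f" "\<And>x. x \<notin> {a..b} \<Longrightarrow> f x = 0" shows "test_function f"
proof -
  have "closure {x. f x \<noteq> 0} \<subseteq> {a..b}" using assms(2) by (intro closure_minimal) fastforce+
  then have "compact (closure {x. f x \<noteq> 0})"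
    by (meson bounded_closed_interval bounded_subset closed_closure compact_eq_bounded_closed)
  then show ?thesis using assms(1) unfolding test_function_def smooth_def by auto
qed

lemma test_functionE:
  assumes "test_function f"
  obtains R where "smooth f" "R > 0" "\<And>x. x \<notin> {-R<..<R} \<Longrightarrow> f x = 0" "\<And>x. x \<notin> {-R<..<R} \<Longrightarrow> deriv f x = 0"
proof -
  have sm: "smooth f" using assms unfolding test_function_def smooth_def by auto
  have "bounded (closure {x. f x \<noteq> 0})" using assms compact_imp_bounded unfolding test_function_def by auto
  then obtain r where r: "r > 0" "\<And>x. x \<in> closure {x. f x \<noteq> 0} \<Longrightarrow> norm x \<le> r"
    by (auto simp: bounded_pos)
  have z: "f x = 0" if "\<bar>x\<bar> > r" for x
    using r(2)[of x] closure_subset[of "{x. f x \<noteq> 0}"] that by fastforce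
  have "deriv f x = 0" if "\<bar>x\<bar> > r" for x
  proof -
    have "open {x::real. \<bar>x\<bar> > r}" by (intro open_Collect_less continuous_intros)
    then have "(f has_real_derivative 0) (at x)"
      by (rule has_field_derivative_transform_within_open[OF DERIV_const[of 0]]) (use that z in auto)
    then show ?thesis by (rule DERIV_imp_deriv)
  qed
  \<comment> \<open>Vanishing is known for |x| > r only; enlarging r by one includes the endpoints
    -R and R, where boundary terms have to drop out later.\<close>
  with z show ?thesis by (intro that[of "r + 1"]) (use sm r(1) in auto)
qed

lemma test_function_deriv:
  assumes "test_function f" shows "test_function (deriv f)"
proof -
  obtain R where "smooth f" "R > 0" "\<And>x. x \<notin> {-R<..<R} \<Longrightarrow> deriv f x = 0"
    using test_functionE[OF assms] by metis
  then show ?thesis by (intro test_functionI[of _ "-R" R] smooth_deriv) auto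
qed

lemma test_function_bump: "n > 0 \<Longrightarrow> test_function (bump n a b)"
  by (rule test_functionI[OF smooth_bump, of a b]) (auto simp: bump_eq)

subsection \<open>Primitives of locally integrable functions\<close>

text \<open>Bisecting an interval halves the bound, because \<open>E y - E x\<close> is additive in the interval.\<close>
lemma const_if_quadratic_increments:
  fixes J :: "real \<Rightarrow> 'a::real_normed_vector"
  assumes J: "\<And>x y. a \<le> x \<Longrightarrow> x \<le> y \<Longrightarrow> y \<le> b \<Longrightarrow> norm (J y - J x) \<le> M * (y - x) * (E y - E x)"
    and "a \<le> b"
  shows "J b = J a"
proof -
  have "norm (J y - J x) \<le> M * (y - x) * (E y - E x) / 2 ^ n" if "a \<le> x" "x \<le> y" "y \<le> b" for x y n
    using that
  proof (induction n arbitrary: x y)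
    case 0
    then show ?case using J by simp
  next
    case (Suc n)
    define m where "m = (x + y) / 2"
    have m: "x \<le> m" "m \<le> y" "y - m = (y - x) / 2" "m - x = (y - x) / 2"
      using Suc.prems by (auto simp: m_def field_simps)
    have "norm (J y - J x) \<le> norm (J y - J m) + norm (J m - J x)"
      using norm_triangle_ineq[of "J y - J m" "J m - J x"] by simp
    also have "\<dots> \<le> M * (y - m) * (E y - E m) / 2 ^ n + M * (m - x) * (E m - E x) / 2 ^ n"
      using Suc.prems m by (intro add_mono Suc.IH) auto
    also have "\<dots> = M * (y - x) * (E y - E x) / 2 ^ Suc n"
      unfolding m by (simp add: field_simps)
    finally show ?case .
  qed
  note this[OF order.refl assms(2) order.refl]
  then have le: "norm (J b - J a) \<le> M * (b - a) * (E b - E a) * (1 / 2) ^ n" for n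
    by (simp only: power_one_over times_divide_eq_right mult_1_right)
  have "(\<lambda>n. M * (b - a) * (E b - E a) * (1 / 2) ^ n) \<longlonglongrightarrow> M * (b - a) * (E b - E a) * 0"
    by (intro tendsto_intros LIMSEQ_realpow_zero) auto
  then have "norm (J b - J a) \<le> M * (b - a) * (E b - E a) * 0"
    by (rule LIMSEQ_le_const) (use le in blast)
  then show ?thesis by simp
qed

section \<open>Locally integrable functions\<close>

lemma L1_loc_iff: "f \<in> L1_loc \<longleftrightarrow> (\<forall>a b. f absolutely_integrable_on {a..b})"
proof
  assume *: "\<forall>a b. f absolutely_integrable_on {a..b}"
  have "set_integrable lebesgue K f" if K: "compact K" for K
  proof -
    obtain a where "K \<subseteq> {-a..a}"
      using bounded_subset_cbox_symmetric[OF compact_imp_bounded, OF K] by (metis cbox_interval)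
    moreover have "K \<in> sets lebesgue" using K by (simp add: borel_compact)
    ultimately show ?thesis using * set_integrable_subset by blast
  qed
  then show "f \<in> L1_loc" by (simp add: L1_loc_def)
qed (auto simp: L1_loc_def)

lemma L1_loc_integrable_on: "f \<in> L1_loc \<Longrightarrow> f integrable_on {a..b}"
  by (auto simp: L1_loc_iff intro: set_lebesgue_integral_eq_integral(1))

lemma L1_loc_measurable: "f \<in> L1_loc \<Longrightarrow> f \<in> borel_measurable lebesgue"
proof -
  assume f: "f \<in> L1_loc"
  have "(\<lambda>x. indicator {-real n..real n} x *\<^sub>R f x) \<in> borel_measurable lebesgue" for n
    using f unfolding L1_loc_iff set_integrable_def by (blast dest: borel_measurable_integrable)
  moreover have "(\<lambda>n. indicator {-real n..real n} x *\<^sub>R f x) \<longlonglongrightarrow> f x" for x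
  proof (rule tendsto_eventually)
    obtain N :: nat where "\<bar>x\<bar> \<le> N" using real_arch_simple by blast
    then show "\<forall>\<^sub>F n in sequentially. indicator {-real n..real n} x *\<^sub>R f x = f x"
      by (intro eventually_sequentiallyI[of N]) (auto simp: indicator_def abs_le_iff)
  qed
  ultimately show ?thesis by (rule borel_measurable_LIMSEQ_metric)
qed

lemma L1_loc_add: "f \<in> L1_loc \<Longrightarrow> g \<in> L1_loc \<Longrightarrow> (\<lambda>x. f x + g x) \<in> L1_loc"
  by (auto simp: L1_loc_def)

lemma L1_loc_continuous: "continuous_on UNIV f \<Longrightarrow> f \<in> L1_loc"
  by (auto simp: L1_loc_iff intro!: absolutely_integrable_continuous_real intro: continuous_on_subset)

text \<open>A continuous factor is bounded on every compact interval.\<close>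

lemma L1_loc_times_continuous:
  assumes "f \<in> L1_loc" "continuous_on UNIV \<phi>" shows "(\<lambda>x. \<phi> x * f x) \<in> L1_loc"
  unfolding L1_loc_iff
proof (intro allI absolutely_integrable_bounded_measurable_product[OF bilinear_times])
  fix a b :: real
  have c: "continuous_on {a..b} \<phi>" using assms(2) continuous_on_subset by blast
  show "\<phi> \<in> borel_measurable (lebesgue_on {a..b})" by (rule continuous_imp_measurable_on_sets_lebesgue[OF c]) auto
  show "bounded (\<phi> ` {a..b})" by (intro compact_imp_bounded compact_continuous_image c) auto
  show "f absolutely_integrable_on {a..b}" using assms by (auto simp: L1_loc_iff)
qed auto

lemma L1_loc_cmult: "f \<in> L1_loc \<Longrightarrow> (\<lambda>x. c * f x) \<in> L1_loc"
  by (rule L1_loc_times_continuous) auto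

lemma L1_loc_diff: "f \<in> L1_loc \<Longrightarrow> g \<in> L1_loc \<Longrightarrow> (\<lambda>x. f x - g x) \<in> L1_loc"
  using L1_loc_add[of f "\<lambda>x. (-1) * g x"] L1_loc_cmult[of g "-1"] by simp

lemma L1_loc_cong_AE:
  assumes "f \<in> L1_loc" "AE x in lebesgue. f x = g x" shows "g \<in> L1_loc"
proof -
  have "g \<in> borel_measurable lebesgue" using borel_measurable_AE assms L1_loc_measurable by blast
  moreover have "set_integrable lebesgue {a..b} f" for a b using assms L1_loc_iff by blast
  ultimately show ?thesis unfolding L1_loc_iff using assms L1_loc_measurable[OF assms(1)]
    by (intro allI) (subst set_integrable_cong_AE[of g _ f], auto)
qed

lemma integral_cong_AE_real:
  fixes f g :: "real \<Rightarrow> complex"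
  assumes "AE x in lebesgue. f x = g x" shows "integral S f = integral S g"
proof -
  obtain N where "negligible N" "{x. f x \<noteq> g x} \<subseteq> N"
    using assms by (auto simp: eventually_ae_filter negligible_iff_null_sets)
  then have "f x = g x" if "x \<notin> N" for x using that by blast
  then show ?thesis using \<open>negligible N\<close> by (intro integral_spike[of N]) auto
qed

text \<open>
  Local absolute continuity with a given derivative, stated as an integral identity so that no
  differentiation theorem for Lebesgue integrals is needed.
\<close>
definition primitive_of :: "(real \<Rightarrow> complex) \<Rightarrow> (real \<Rightarrow> complex) \<Rightarrow> bool" where
  "primitive_of g F \<longleftrightarrow> g \<in> L1_loc \<and> (\<forall>x y. x \<le> y \<longrightarrow> F y - F x = integral {x..y} g)"

lemma primitive_of_diff: "primitive_of g F \<Longrightarrow> x \<le> y \<Longrightarrow> F y - F x = integral {x..y} g"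
  by (auto simp: primitive_of_def)

lemma primitive_of_exists:
  assumes "g \<in> L1_loc" obtains F where "primitive_of g F"
proof
  note i = L1_loc_integrable_on[OF assms]
  define F where "F x = (if 0 \<le> x then integral {0..x} g else - integral {x..0} g)" for x
  have "F y - F x = integral {x..y} g" if "x \<le> y" for x y
    using that Henstock_Kurzweil_Integration.integral_combine[of 0 x y g, OF _ _ i]
      Henstock_Kurzweil_Integration.integral_combine[of x 0 y g, OF _ _ i]
      Henstock_Kurzweil_Integration.integral_combine[of x y 0 g, OF _ _ i]
    by (auto simp: F_def algebra_simps not_le)
  then show "primitive_of g F" using assms by (auto simp: primitive_of_def)
qed

text \<open>On [-n, n] the function \<open>F\<close> is a constant plus an indefinite integral, and
  the open intervals (-n, n) cover the line.\<close>

lemma primitive_of_continuous: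
  assumes "primitive_of g F" shows "continuous_on UNIV F"
proof -
  have "continuous_on {-real n<..<real n} F" for n
  proof -
    have "continuous_on {-real n..real n} (\<lambda>x. F (-real n) + integral {-real n..x} g)"
      using assms by (intro continuous_intros indefinite_integral_continuous_1 L1_loc_integrable_on)
        (auto simp: primitive_of_def)
    then have "continuous_on {-real n..real n} F"
      by (rule continuous_on_eq) (use primitive_of_diff[OF assms] in \<open>force simp: algebra_simps\<close>)
    then show ?thesis by (rule continuous_on_subset) auto
  qed
  then have "continuous_on (\<Union>n. {-real n<..<real n}) F" by (intro continuous_on_open_UN) auto
  moreover have "(\<Union>n. {-real n<..<real n}) = UNIV"
  proof -
    have "\<exists>n. \<bar>x\<bar> < real n" for x :: real by (rule reals_Archimedean2)
    then show ?thesis by (force simp: abs_less_iff)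
  qed
  ultimately show ?thesis by simp
qed

lemma primitive_of_cong_AE:
  assumes "primitive_of g F" "AE x in lebesgue. g x = h x" shows "primitive_of h F"
  using assms L1_loc_cong_AE integral_cong_AE_real[OF assms(2)] unfolding primitive_of_def by metis

lemma primitive_of_lincomb:
  assumes "primitive_of g F" "primitive_of h H"
  shows "primitive_of (\<lambda>x. g x + c * h x) (\<lambda>x. F x + c * H x)"
proof -
  have 1: "g \<in> L1_loc" "(\<lambda>x. c * h x) \<in> L1_loc" using assms L1_loc_cmult by (auto simp: primitive_of_def)
  have "(F y + c * H y) - (F x + c * H x) = integral {x..y} (\<lambda>x. g x + c * h x)" if "x \<le> y" for x y
  proof -
    have "integral {x..y} (\<lambda>x. g x + c * h x) = integral {x..y} g + c * integral {x..y} h"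
      by (simp add: Henstock_Kurzweil_Integration.integral_add[OF 1[THEN L1_loc_integrable_on]])
    moreover have "F y = F x + integral {x..y} g" "H y = H x + integral {x..y} h"
      using primitive_of_diff[OF assms(1) that] primitive_of_diff[OF assms(2) that] by (simp_all add: algebra_simps)
    ultimately show ?thesis by (simp add: algebra_simps)
  qed
  then show ?thesis using L1_loc_add[OF 1] by (auto simp: primitive_of_def)
qed

text \<open>
  On an interval \<open>[x, y]\<close> the defect in the identity is at most a constant times \<open>y - x\<close> times the integral
  of \<open>|g|\<close>, so it vanishes by bisection.
\<close>
lemma primitive_of_by_parts:
  fixes \<phi> \<phi>' :: "real \<Rightarrow> complex"
  assumes F: "primitive_of g F" and d: "\<And>t. (\<phi> has_vector_derivative \<phi>' t) (at t)"
    and c: "continuous_on UNIV \<phi>'"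
  shows "primitive_of (\<lambda>t. \<phi>' t * F t + \<phi> t * g t) (\<lambda>t. \<phi> t * F t)"
proof -
  define w where "w t = \<phi>' t * F t + \<phi> t * g t" for t
  have gl: "g \<in> L1_loc" using F by (simp add: primitive_of_def)
  have cF: "continuous_on UNIV F" using F by (rule primitive_of_continuous)
  have c\<phi>: "continuous_on UNIV \<phi>"
    by (auto intro!: continuous_at_imp_continuous_on has_vector_derivative_continuous[OF d])
  have wl: "w \<in> L1_loc" unfolding w_def[abs_def]
    by (intro L1_loc_add L1_loc_times_continuous gl c\<phi> L1_loc_continuous continuous_intros c cF)
  obtain W where W: "primitive_of w W" using primitive_of_exists[OF wl] .
  have "W b - \<phi> b * F b = W a - \<phi> a * F a" if ab: "a \<le> b" for a b
  proof -
    have "bounded (\<phi>' ` {a..b})"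
      by (intro compact_imp_bounded compact_continuous_image continuous_on_subset[OF c]) auto
    then obtain M where M: "M > 0" "\<And>t. a \<le> t \<Longrightarrow> t \<le> b \<Longrightarrow> norm (\<phi>' t) \<le> M"
      by (auto simp: bounded_pos)
    show ?thesis
    proof (rule const_if_quadratic_increments[OF _ ab])
      define E where "E x = integral {a..x} (\<lambda>t. norm (g t))" for x
      have ng: "(\<lambda>t. norm (g t)) integrable_on {x..y}" for x y
        using gl by (simp add: L1_loc_iff absolutely_integrable_on_def)
      fix x y assume xy: "a \<le> x" "x \<le> y" "y \<le> b"
      define N where "N = integral {x..y} (\<lambda>t. norm (g t))"
      have N: "N = E y - E x"
        using Henstock_Kurzweil_Integration.integral_combine[OF xy(1,2) ng] by (simp add: E_def N_def)
      have \<phi>': "(\<phi>' has_integral (\<phi> y - \<phi> x)) {x..y}"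
        using xy d by (intro fundamental_theorem_of_calculus) (auto intro: has_vector_derivative_at_within)
      have g: "(g has_integral (F y - F x)) {x..y}"
        using primitive_of_diff[OF F xy(2)] L1_loc_integrable_on[OF gl] by (simp add: has_integral_integral)
      have w: "(w has_integral (W y - W x)) {x..y}"
        using primitive_of_diff[OF W xy(2)] L1_loc_integrable_on[OF wl] by (simp add: has_integral_integral)
      \<comment> \<open>Since \<open>\<phi> y * F y - \<phi> x * F x = F x * (\<phi> y - \<phi> x) +
        \<phi> y * (F y - F x)\<close>, the value of this integral is the increment of
        \<open>W - \<phi> F\<close> over [x, y].\<close>
      have v: "((\<lambda>t. w t - F x * \<phi>' t - \<phi> y * g t) has_integral
         (W y - W x - F x * (\<phi> y - \<phi> x) - \<phi> y * (F y - F x))) {x..y}"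
        by (intro has_integral_diff has_integral_mult_right w \<phi>' g)
      \<comment> \<open>Both summands integrate to \<open>M * (y - x) * N\<close>, whence the
        constant \<open>2 * M\<close> in the final bound.\<close>
      have u: "((\<lambda>t. M * N + M * (y - x) * norm (g t)) has_integral (M * N * (y - x) + M * (y - x) * N)) {x..y}"
      proof (intro has_integral_add has_integral_mult_right)
        show "((\<lambda>t. M * N) has_integral M * N * (y - x)) {x..y}"
          using has_integral_const_real[of "M * N" x y] xy by (simp add: mult.commute)
        show "((\<lambda>t. norm (g t)) has_integral N) {x..y}" using ng by (simp add: N_def has_integral_integral)
      qed
      have "norm (w t - F x * \<phi>' t - \<phi> y * g t) \<le> M * N + M * (y - x) * norm (g t)" if t: "t \<in> {x..y}" for t
      proof -
        have "norm (F t - F x) \<le> integral {x..t} (\<lambda>t. norm (g t))"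
          using t primitive_of_diff[OF F, of x t] by (simp add: integral_norm_bound_integral L1_loc_integrable_on gl ng)
        also have "\<dots> \<le> N" unfolding N_def
          using t by (intro integral_subset_le ng) auto
        finally have 1: "norm (F t - F x) \<le> N" .
        have "(\<phi>' has_integral (\<phi> y - \<phi> t)) {t..y}"
          using t d by (intro fundamental_theorem_of_calculus) (auto intro: has_vector_derivative_at_within)
        then have "norm (\<phi> y - \<phi> t) \<le> M * measure lborel {t..y}"
          using M t xy by (intro has_integral_bound_real[where f=\<phi>']) auto
        also have "\<dots> \<le> M * (y - x)" using t M by (simp add: mult_left_mono)
        finally have 2: "norm (\<phi> t - \<phi> y) \<le> M * (y - x)" by (simp add: norm_minus_commute)
        \<comment> \<open>Each of the two products contains an increment: bound 1 controls that of
          \<open>F\<close>, bound 2 that of \<open>\<phi>\<close>.\<close>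
        have "w t - F x * \<phi>' t - \<phi> y * g t = \<phi>' t * (F t - F x) + (\<phi> t - \<phi> y) * g t"
          by (simp add: w_def algebra_simps)
        also have "norm \<dots> \<le> norm (\<phi>' t) * norm (F t - F x) + norm (\<phi> t - \<phi> y) * norm (g t)"
          by (metis norm_mult norm_triangle_ineq)
        also have "\<dots> \<le> M * N + M * (y - x) * norm (g t)"
          using 1 2 M xy t by (intro add_mono mult_mono) auto
        finally show ?thesis .
      qed
      then have le: "norm (W y - W x - F x * (\<phi> y - \<phi> x) - \<phi> y * (F y - F x)) \<le> M * N * (y - x) + M * (y - x) * N"
        using Henstock_Kurzweil_Integration.integral_norm_bound_integral[of "\<lambda>t. w t - F x * \<phi>' t - \<phi> y * g t" "{x..y}"] v u
        by (metis (no_types, lifting) has_integral_integrable integral_unique)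
      show "norm (W y - \<phi> y * F y - (W x - \<phi> x * F x)) \<le> (2 * M) * (y - x) * (E y - E x)"
      proof -
        have "W y - W x - F x * (\<phi> y - \<phi> x) - \<phi> y * (F y - F x) = W y - \<phi> y * F y - (W x - \<phi> x * F x)"
          "M * N * (y - x) + M * (y - x) * N = (2 * M) * (y - x) * N" by algebra+
        then show ?thesis using le unfolding N[symmetric] by (simp only:)
      qed
    qed
  qed
  note eq = this
  have "\<phi> b * F b - \<phi> a * F a = W b - W a" if "a \<le> b" for a b
    using eq[OF that] by algebra
  then show ?thesis using W unfolding primitive_of_def w_def by simp
qed

subsection \<open>Weak derivatives\<close>

lemma sigma_finite_lebesgue: "sigma_finite_measure (lebesgue :: real measure)"
proof
  obtain A :: "real set set" where "countable A \<and> A \<subseteq> sets lborel \<and> \<Union>A = space lborel \<and> (\<forall>a\<in>A. emeasure lborel a \<noteq> \<infinity>)"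
    using lborel.sigma_finite_countable by blast
  then show "\<exists>A::real set set. countable A \<and> A \<subseteq> sets lebesgue \<and> \<Union>A = space lebesgue \<and> (\<forall>a\<in>A. emeasure lebesgue a \<noteq> \<infinity>)"
    by (intro exI[of _ A]) auto
qed

text \<open>The Borel sets over which \<open>f\<close> has integral 0 form a Dynkin system; the
  total integral being 0 gives closure under complements. It contains the intersection-stable
  generator of open intervals, hence all Borel sets, and a Lebesgue set differs from a Borel set by
  a null set.\<close>

lemma AE_eq_0_if_interval_integrals_0:
  fixes f :: "real \<Rightarrow> complex"
  assumes f: "integrable lebesgue f" and i: "\<And>a b. (LINT x:{a<..<b}|lebesgue. f x) = 0"
    and "(LINT x|lebesgue. f x) = 0"
  shows "AE x in lebesgue. f x = 0"
proof (rule sigma_finite_measure.density_zero[OF sigma_finite_lebesgue f])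
  have m: "set_borel_measurable lebesgue A f" if "A \<in> sets lebesgue" for A
    using integrable_mult_indicator[OF that f] by (auto simp: set_borel_measurable_def)
  have si: "set_integrable lebesgue A f" if "A \<in> sets lebesgue" for A
    using integrable_mult_indicator[OF that f] by (auto simp: set_integrable_def)
  have B: "(LINT x:A|lebesgue. f x) = 0" if "A \<in> sets borel" for A
  proof -
    have eq: "sets borel = sigma_sets UNIV (range (\<lambda>(a, b). {a<..<b::real}))"
      by (subst borel_eq_box) (simp add: box_real(1)[abs_def])
    have le: "X \<in> sets lebesgue" if "X \<in> sigma_sets UNIV (range (\<lambda>(a, b). {a<..<b::real}))" for X
      using that unfolding eq[symmetric] by simp
    show ?thesis
    proof (rule sigma_sets_induct_disjoint[OF _ _ that[unfolded eq]])
      show "Int_stable (range (\<lambda>(a, b). {a<..<b::real}))"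
      proof (rule Int_stableI)
        fix X Y assume "X \<in> range (\<lambda>(a, b). {a<..<b::real})" "Y \<in> range (\<lambda>(a, b). {a<..<b::real})"
        then obtain a b c d where "X = {a<..<b}" "Y = {c<..<d}" by auto
        then have "X \<inter> Y = {max a c<..<min b d}" by auto
        then show "X \<inter> Y \<in> range (\<lambda>(a, b). {a<..<b::real})" by auto
      qed
    next
      fix X assume X: "X \<in> sigma_sets UNIV (range (\<lambda>(a, b). {a<..<b::real}))" "(LINT x:X|lebesgue. f x) = 0"
      have "(LINT x:X \<union> (UNIV - X)|lebesgue. f x) = (LINT x:X|lebesgue. f x) + (LINT x:UNIV - X|lebesgue. f x)"
        using le[OF X(1)] by (intro set_integral_Un si) auto
      then show "(LINT x:UNIV - X|lebesgue. f x) = 0"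
        using assms(3) X(2) by (simp add: set_lebesgue_integral_def)
    next
      fix X :: "nat \<Rightarrow> real set" assume X: "disjoint_family X" "range X \<subseteq> sigma_sets UNIV (range (\<lambda>(a, b). {a<..<b::real}))"
        "\<And>i. (LINT x:X i|lebesgue. f x) = 0"
      have "X i \<in> sets lebesgue" for i using X(2) le by blast
      then have "(LINT x:(\<Union>i. X i)|lebesgue. f x) = (\<Sum>i. LINT x:X i|lebesgue. f x)"
        using X(1) by (intro lebesgue_integral_countable_add si) (auto simp: disjoint_family_on_def)
      then show "(LINT x:(\<Union>i. X i)|lebesgue. f x) = 0" using X(3) by simp
    qed (use i in \<open>auto simp: set_lebesgue_integral_def\<close>)
  qed
  fix A :: "real set" assume A: "A \<in> sets lebesgue"
  then obtain S N N' where S: "A = S \<union> N" "N \<subseteq> N'" "N' \<in> null_sets lborel" "S \<in> sets lborel"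
    by (rule sets_completionE)
  have "AE x in lebesgue. x \<notin> N'" using S(3) by (intro AE_completion AE_not_in)
  then have "AE x in lebesgue. x \<in> S \<longleftrightarrow> x \<in> A" by (rule AE_mp) (use S in auto)
  then have "(LINT x:A|lebesgue. f x) = (LINT x:S|lebesgue. f x)"
    using S A by (intro set_integral_cong_set m) auto
  then show "(LINT x:A|lebesgue. f x) = 0" using B S(4) by simp
qed

text \<open>Converts the Lebesgue integrals of \<open>has_weak_derivative\<close> into integrals
  over a bounded interval, the form in which \<open>primitive_of\<close> is stated.\<close>

lemma integral_times_compact_support:
  fixes f :: "real \<Rightarrow> complex" and \<phi> :: "real \<Rightarrow> real"
  assumes f: "f \<in> L1_loc" and c: "continuous_on UNIV \<phi>" and z: "\<And>x. x \<notin> {a..b} \<Longrightarrow> \<phi> x = 0"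
  shows "integrable lebesgue (\<lambda>x. \<phi> x *\<^sub>R f x)"
    and "(LINT x|lebesgue. \<phi> x *\<^sub>R f x) = integral {a..b} (\<lambda>x. of_real (\<phi> x) * f x)"
proof -
  have "(\<lambda>x. of_real (\<phi> x) * f x) \<in> L1_loc" by (intro L1_loc_times_continuous f continuous_intros c)
  then have *: "set_integrable lebesgue {a..b} (\<lambda>x. of_real (\<phi> x) * f x)" by (simp add: L1_loc_iff)
  have eq: "indicator {a..b} x *\<^sub>R (of_real (\<phi> x) * f x) = \<phi> x *\<^sub>R f x" for x
    using z[of x] by (auto simp: indicator_def scaleR_conv_of_real)
  show "integrable lebesgue (\<lambda>x. \<phi> x *\<^sub>R f x)" using * unfolding set_integrable_def eq .
  show "(LINT x|lebesgue. \<phi> x *\<^sub>R f x) = integral {a..b} (\<lambda>x. of_real (\<phi> x) * f x)"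
    using set_lebesgue_integral_eq_integral(2)[OF *] unfolding set_lebesgue_integral_def eq .
qed

text \<open>Bumps tend to the indicator of (a, b) and are dominated by that of [a, b], so
  \<open>w\<close> integrates to 0 over every bounded open interval. Since \<open>w\<close> is only
  locally integrable, the previous criterion is applied to its truncations to (-n, n).\<close>

theorem fundamental_lemma_calculus_of_variations:
  assumes w: "w \<in> L1_loc" and z: "\<And>\<phi>. test_function \<phi> \<Longrightarrow> (LINT x|lebesgue. \<phi> x *\<^sub>R w x) = 0"
  shows "AE x in lebesgue. w x = 0"
proof -
  have i: "(LINT x:{a<..<b}|lebesgue. w x) = 0" for a b
  proof -
    have "(\<lambda>n. LINT x|lebesgue. bump (real (Suc n)) a b x *\<^sub>R w x) \<longlonglongrightarrow> (LINT x:{a<..<b}|lebesgue. w x)"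
      unfolding set_lebesgue_integral_def
    proof (rule integral_dominated_convergence[where w="\<lambda>x. indicator {a..b} x * norm (w x)"])
      show "integrable lebesgue (\<lambda>x. indicator {a..b} x * norm (w x))"
        using w set_integrable_norm[of lebesgue "{a..b}" w] by (simp add: L1_loc_iff set_integrable_def)
      show "(\<lambda>x. indicat_real {a<..<b} x *\<^sub>R w x) \<in> borel_measurable lebesgue"
        using L1_loc_measurable[OF w] by (intro borel_measurable_scaleR borel_measurable_indicator) auto
      show "(\<lambda>x. bump (real (Suc n)) a b x *\<^sub>R w x) \<in> borel_measurable lebesgue" for n
        by (intro borel_measurable_integrable integral_times_compact_support(1)[where a=a and b=b] w smooth_continuous_on smooth_bump)
           (auto simp: bump_eq)
      show "AE x in lebesgue. (\<lambda>n. bump (real (Suc n)) a b x *\<^sub>R w x) \<longlonglongrightarrow> indicat_real {a<..<b} x *\<^sub>R w x"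
        by (intro AE_I2 tendsto_scaleR bump_tendsto tendsto_const)
      have "norm (bump (real (Suc n)) a b x *\<^sub>R w x) \<le> indicator {a..b} x * norm (w x)" for n x
      proof -
        have "0 \<le> bump (real (Suc n)) a b x" by (rule bump_bounds) simp
        moreover have "bump (real (Suc n)) a b x \<le> indicator {a..b} x"
          by (rule order_trans[OF bump_bounds(2)]) (auto simp: indicator_def)
        ultimately show ?thesis unfolding norm_scaleR by (intro mult_right_mono) auto
      qed
      then show "AE x in lebesgue. norm (bump (real (Suc n)) a b x *\<^sub>R w x) \<le> indicator {a..b} x * norm (w x)" for n
        by simp
    qed
    moreover have "(LINT x|lebesgue. bump (real (Suc n)) a b x *\<^sub>R w x) = 0" for n
      by (intro z test_function_bump) simp
    ultimately show ?thesis by (simp add: LIMSEQ_const_iff)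
  qed
  have "AE x in lebesgue. indicator {- real n<..<real n} x *\<^sub>R w x = 0" for n
  proof (rule AE_eq_0_if_interval_integrals_0)
    have "set_integrable lebesgue {- real n<..<real n} w"
      by (rule set_integrable_subset[of _ "{- real n..real n}"]) (use w L1_loc_iff in auto)
    then show "integrable lebesgue (\<lambda>x. indicator {- real n<..<real n} x *\<^sub>R w x)" by (simp add: set_integrable_def)
    show "(LINT x|lebesgue. indicator {- real n<..<real n} x *\<^sub>R w x) = 0"
      using i unfolding set_lebesgue_integral_def .
    show "(LINT x:{a<..<b}|lebesgue. indicator {- real n<..<real n} x *\<^sub>R w x) = 0" for a b
    proof -
      have eq: "indicator {a<..<b} x *\<^sub>R (indicator {- real n<..<real n} x *\<^sub>R w x)
        = indicator {max a (- real n)<..<min b (real n)} x *\<^sub>R w x" for x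
        by (auto simp: indicator_def)
      show ?thesis using i[of "max a (- real n)" "min b (real n)"] unfolding set_lebesgue_integral_def eq .
    qed
  qed
  then have "AE x in lebesgue. \<forall>n. indicator {- real n<..<real n} x *\<^sub>R w x = 0"
    unfolding AE_all_countable by blast
  then show ?thesis
  proof (rule AE_mp, intro AE_I2 impI)
    fix x assume *: "\<forall>n. indicator {- real n<..<real n} x *\<^sub>R w x = 0"
    obtain n where "\<bar>x\<bar> < real n" using reals_Archimedean2 by blast
    then show "w x = 0" using *[rule_format, of n] by (auto simp: indicator_def abs_less_iff split: if_splits)
  qed
qed

text \<open>Integration by parts on [-R, R], where \<phi> vanishes at both endpoints.\<close>

lemma integral_deriv_primitive:
  assumes G: "primitive_of g G" and \<phi>: "test_function \<phi>"
  shows "(LINT x|lebesgue. deriv \<phi> x *\<^sub>R G x) = - (LINT x|lebesgue. \<phi> x *\<^sub>R g x)"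
proof -
  obtain R where R: "smooth \<phi>" "R > 0" "\<And>x. x \<notin> {-R<..<R} \<Longrightarrow> \<phi> x = 0" "\<And>x. x \<notin> {-R<..<R} \<Longrightarrow> deriv \<phi> x = 0"
    using test_functionE[OF \<phi>] by metis
  have gl: "g \<in> L1_loc" using G by (simp add: primitive_of_def)
  have cG: "continuous_on UNIV G" by (rule primitive_of_continuous[OF G])
  have c: "continuous_on UNIV \<phi>" "continuous_on UNIV (deriv \<phi>)"
    using R(1) by (auto intro: smooth_continuous_on smooth_deriv)
  have l: "(\<lambda>t. of_real (deriv \<phi> t) * G t) \<in> L1_loc" "(\<lambda>t. of_real (\<phi> t) * g t) \<in> L1_loc"
    by (intro L1_loc_times_continuous gl L1_loc_continuous continuous_intros c cG)+
  have "primitive_of (\<lambda>t. of_real (deriv \<phi> t) * G t + of_real (\<phi> t) * g t) (\<lambda>t. of_real (\<phi> t) * G t)"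
    using R(1) c by (intro primitive_of_by_parts[OF G] continuous_intros has_vector_derivative_of_real)
      (auto intro: smooth_has_deriv simp flip: has_real_derivative_iff_has_vector_derivative)
  from primitive_of_diff[OF this, of "-R" R]
  have "integral {-R..R} (\<lambda>t. of_real (deriv \<phi> t) * G t + of_real (\<phi> t) * g t) = 0"
    using R by simp
  then have "integral {-R..R} (\<lambda>t. of_real (deriv \<phi> t) * G t) = - integral {-R..R} (\<lambda>t. of_real (\<phi> t) * g t)"
    by (simp add: Henstock_Kurzweil_Integration.integral_add l[THEN L1_loc_integrable_on] add_eq_0_iff2)
  moreover have "(LINT x|lebesgue. \<phi> x *\<^sub>R g x) = integral {-R..R} (\<lambda>t. of_real (\<phi> t) * g t)"
    by (rule integral_times_compact_support(2)[OF gl c(1)]) (rule R(3), auto)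
  moreover have "(LINT x|lebesgue. deriv \<phi> x *\<^sub>R G x) = integral {-R..R} (\<lambda>t. of_real (deriv \<phi> t) * G t)"
    by (rule integral_times_compact_support(2)[OF L1_loc_continuous[OF cG] c(2)]) (rule R(4), auto)
  ultimately show ?thesis by simp
qed

lemma has_weak_derivative_primitive: "primitive_of g G \<Longrightarrow> has_weak_derivative 1 G g"
  using L1_loc_continuous[OF primitive_of_continuous, of g G] integral_deriv_primitive[of g G]
  by (simp add: has_weak_derivative_def primitive_of_def)

section \<open>The du Bois-Reymond lemma and its consequences\<close>

lemma test_function_antiderivative:
  assumes \<psi>: "test_function \<psi>" and "(LINT x|lebesgue. \<psi> x) = 0"
  obtains \<phi> where "test_function \<phi>" "deriv \<phi> = \<psi>"
proof -
  obtain R where R: "smooth \<psi>" "R > 0" "\<And>x. x \<notin> {-R<..<R} \<Longrightarrow> \<psi> x = 0"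
    using test_functionE[OF \<psi>] by metis
  have c: "continuous_on S \<psi>" for S by (rule smooth_continuous_on[OF R(1)])
  define \<phi> where "\<phi> x = (LBINT t=-R..x. \<psi> t)" for x :: real
  have d: "(\<phi> has_real_derivative \<psi> x) (at x)" for x
  proof -
    \<comment> \<open>The interval [-m, m] contains the base point -R and has x in its interior, so
      the derivative within it is a full derivative.\<close>
    define m where "m = max \<bar>x\<bar> R + 1"
    have "((\<lambda>u. LBINT t=-R..u. \<psi> t) has_vector_derivative \<psi> x) (at x within {-m..m})"
      by (rule interval_integral_FTC2) (use R(2) in \<open>auto simp: m_def intro: c\<close>)
    then have "(\<phi> has_vector_derivative \<psi> x) (at x within {-m..m})" by (simp add: \<phi>_def[abs_def])
    moreover have "x \<in> interior {-m..m}" by (auto simp: m_def)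
    ultimately show ?thesis
      unfolding has_real_derivative_iff_has_vector_derivative by (metis at_within_interior)
  qed
  have "\<phi> x = 0" if "x \<notin> {-R..R}" for x
  proof -
    have z: "(LBINT t=a..b. \<psi> t) = integral {a..b} \<psi>" if "a \<le> b" for a b
      by (intro interval_integral_eq_integral that borel_integrable_atLeastAtMost' c)
    have 0: "integral {a..b} \<psi> = 0" if "b \<le> -R \<or> R \<le> a" for a b
      by (subst integral_cong[of _ _ "\<lambda>x. 0"]) (use that R in auto)
    show ?thesis
    proof (cases "x < -R")
      case True
      have "\<phi> x = - (LBINT t=x..-R. \<psi> t)" unfolding \<phi>_def by (rule interval_integral_endpoints_reverse)
      then show ?thesis using z[of x "-R"] 0[of "-R" x] True by simp
    next
      case False
      \<comment> \<open>To the right of the support the integral from -R is the total integral of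
        \<psi>, which is zero by assumption.\<close>
      with that have "x \<ge> R" by auto
      have si: "set_integrable lebesgue {-R..R} \<psi>"
        using absolutely_integrable_continuous_real[OF c] by blast
      have "(LINT x|lebesgue. \<psi> x) = (LINT x:{-R..R}|lebesgue. \<psi> x)"
        unfolding set_lebesgue_integral_def
      proof (rule Bochner_Integration.integral_cong)
        show "\<psi> x = indicator {-R..R} x *\<^sub>R \<psi> x" for x
          by (cases "x \<in> {-R..R}") (auto simp: R(3))
      qed simp
      also have "\<dots> = integral {-R..R} \<psi>" by (rule set_lebesgue_integral_eq_integral(2)[OF si])
      finally have "integral {-R..R} \<psi> = 0" using assms(2) by simp
      moreover have "integral {-R..R} \<psi> + integral {R..x} \<psi> = integral {-R..x} \<psi>"
        using R \<open>x \<ge> R\<close> by (intro Henstock_Kurzweil_Integration.integral_combine integrable_continuous_real c) auto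
      ultimately show ?thesis unfolding \<phi>_def using z[of "-R" x] 0[of x R] R \<open>x \<ge> R\<close> by simp
    qed
  qed
  then have "test_function \<phi>" by (intro test_functionI[of _ "-R" R] smooth_antideriv[OF R(1) d])
  moreover have "deriv \<phi> = \<psi>" using d by (auto intro!: ext DERIV_imp_deriv)
  ultimately show ?thesis using that by blast
qed

lemma test_function_integrable:
  assumes "test_function \<phi>" shows "integrable lebesgue \<phi>"
proof -
  obtain R where R: "smooth \<phi>" "\<And>x. x \<notin> {-R<..<R} \<Longrightarrow> \<phi> x = 0"
    using test_functionE[OF assms] by metis
  have "set_integrable lebesgue {-R..R} \<phi>"
    using absolutely_integrable_continuous_real[OF smooth_continuous_on[OF R(1)]] by blast
  moreover have "indicator {-R..R} x *\<^sub>R \<phi> x = \<phi> x" for x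
    by (cases "x \<in> {-R..R}") (auto simp: R(2))
  ultimately show ?thesis unfolding set_integrable_def by (simp only:)
qed

lemma test_function_times_integrable:
  assumes "test_function \<phi>" "f \<in> L1_loc" shows "integrable lebesgue (\<lambda>x. \<phi> x *\<^sub>R f x)"
proof -
  obtain R where R: "smooth \<phi>" "\<And>x. x \<notin> {-R<..<R} \<Longrightarrow> \<phi> x = 0"
    using test_functionE[OF assms(1)] by metis
  show ?thesis
    by (rule integral_times_compact_support(1)[OF assms(2) smooth_continuous_on[OF R(1)], of "-R" R]) (rule R(2), auto)
qed

lemma test_function_lincomb:
  assumes "test_function \<phi>" "test_function \<psi>" shows "test_function (\<lambda>x. \<phi> x - c * \<psi> x)"
proof -
  obtain R where R: "smooth \<phi>" "\<And>x. x \<notin> {-R<..<R} \<Longrightarrow> \<phi> x = 0" using test_functionE[OF assms(1)] by metis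
  obtain S where S: "smooth \<psi>" "\<And>x. x \<notin> {-S<..<S} \<Longrightarrow> \<psi> x = 0" using test_functionE[OF assms(2)] by metis
  have "\<phi> x - c * \<psi> x = 0" if "x \<notin> {- max R S..max R S}" for x
  proof -
    have "x \<notin> {-R<..<R}" "x \<notin> {-S<..<S}" using that by auto
    then show ?thesis using R(2) S(2) by simp
  qed
  then show ?thesis by (rule test_functionI[OF smooth_lincomb[OF R(1) S(1)]])
qed

text \<open>A bump is nonnegative and does not vanish on (0, 1), so its integral is nonzero and can
  be normalised.\<close>

lemma ex_test_function_integral_1:
  obtains \<rho> where "test_function \<rho>" "(LINT x|lebesgue. \<rho> x) = 1"
proof -
  let ?b = "bump 1 0 1"
  define I where "I = (LINT x|lebesgue. ?b x)"
  have t: "test_function ?b" by (rule test_function_bump) simp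
  have "I \<noteq> 0"
  proof
    assume "I = 0"
    then have "AE x in lebesgue. ?b x = 0"
      using integral_nonneg_eq_0_iff_AE[OF test_function_integrable[OF t]] bump_bounds(1)[of 1 0 1] by (auto simp: I_def)
    then obtain N where N: "negligible N" "{x. ?b x \<noteq> 0} \<subseteq> N"
      by (auto simp: eventually_ae_filter negligible_iff_null_sets)
    have "{0<..<1} \<subseteq> {x. ?b x \<noteq> 0}" by (auto simp: bump_eq)
    then have "negligible {0<..<1::real}" using N by (meson negligible_subset order_trans)
    then show False using open_not_negligible[of "{0<..<1::real}"] by auto
  qed
  \<comment> \<open>The rescaled bump is written in the form \<open>\<phi> x - c * \<psi> x\<close>
    of \<open>test_function_lincomb\<close>, with the zero function as minuend and c = -1/I.\<close>
  have "test_function (\<lambda>x. 0 * ?b x - (- 1 / I) * ?b x)"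
    using test_function_lincomb[OF test_function_lincomb[OF t t, of 1] t, of "-1/I"] by simp
  then show ?thesis by (rule that) (use \<open>I \<noteq> 0\<close> in \<open>simp add: I_def\<close>)
qed

text \<open>Subtracting from a test function \<eta> its integral times \<rho> leaves mean zero,
  hence the derivative of a test function. Testing \<open>w\<close> against it says that w - C is
  orthogonal to \<eta>, where C is the integral of \<rho> w.\<close>

lemma du_Bois_Reymond:
  assumes w: "w \<in> L1_loc" and z: "\<And>\<phi>. test_function \<phi> \<Longrightarrow> (LINT x|lebesgue. deriv \<phi> x *\<^sub>R w x) = 0"
  obtains C where "AE x in lebesgue. w x = C"
proof -
  obtain \<rho> where \<rho>: "test_function \<rho>" "(LINT x|lebesgue. \<rho> x) = 1" by (rule ex_test_function_integral_1)
  define C where "C = (LINT x|lebesgue. \<rho> x *\<^sub>R w x)"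
  have "AE x in lebesgue. w x - C = 0"
  proof (rule fundamental_lemma_calculus_of_variations)
    show "(\<lambda>x. w x - C) \<in> L1_loc" by (intro L1_loc_diff w L1_loc_continuous) auto
    fix \<eta> assume \<eta>: "test_function \<eta>"
    define c where "c = (LINT x|lebesgue. \<eta> x)"
    have "(LINT x|lebesgue. \<eta> x - c * \<rho> x) = 0"
      using \<rho> \<eta> by (simp add: test_function_integrable c_def)
    then obtain \<phi> where \<phi>: "test_function \<phi>" "deriv \<phi> = (\<lambda>x. \<eta> x - c * \<rho> x)"
      using test_function_antiderivative[OF test_function_lincomb[OF \<eta> \<rho>(1)]] by metis
    have "0 = (LINT x|lebesgue. (\<eta> x - c * \<rho> x) *\<^sub>R w x)" using z[OF \<phi>(1)] \<phi>(2) by simp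
    also have "\<dots> = (LINT x|lebesgue. \<eta> x *\<^sub>R w x - c *\<^sub>R (\<rho> x *\<^sub>R w x))"
      by (simp add: scaleR_diff_left flip: scaleR_scaleR)
    also have "\<dots> = (LINT x|lebesgue. \<eta> x *\<^sub>R w x) - c *\<^sub>R C"
      unfolding C_def using test_function_times_integrable[OF \<eta> w] test_function_times_integrable[OF \<rho>(1) w]
      by (subst Bochner_Integration.integral_diff) (auto simp del: scaleR_scaleR)
    also have "c *\<^sub>R C = (LINT x|lebesgue. \<eta> x *\<^sub>R C)"
      unfolding c_def using test_function_integrable[OF \<eta>] by simp
    also have "(LINT x|lebesgue. \<eta> x *\<^sub>R w x) - (LINT x|lebesgue. \<eta> x *\<^sub>R C) = (LINT x|lebesgue. \<eta> x *\<^sub>R (w x - C))"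
      using test_function_times_integrable[OF \<eta> w] test_function_integrable[OF \<eta>]
      by (simp add: scaleR_diff_right)
    finally show "(LINT x|lebesgue. \<eta> x *\<^sub>R (w x - C)) = 0" by simp
  qed
  then show ?thesis by (intro that[of C]) simp
qed

text \<open>The difference of \<open>f\<close> and any primitive of \<open>g\<close> has weak
  derivative zero, so it is constant almost everywhere, and the constant can be absorbed into the
  primitive.\<close>

lemma weak_derivative_primitive:
  assumes "has_weak_derivative 1 f g"
  obtains F where "primitive_of g F" "AE x in lebesgue. f x = F x"
proof -
  have f: "f \<in> L1_loc" "g \<in> L1_loc"
    and d: "\<And>\<phi>. test_function \<phi> \<Longrightarrow> (LINT x|lebesgue. deriv \<phi> x *\<^sub>R f x) = - (LINT x|lebesgue. \<phi> x *\<^sub>R g x)"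
    using assms by (auto simp: has_weak_derivative_def)
  obtain G where G: "primitive_of g G" using primitive_of_exists[OF f(2)] .
  have Gl: "G \<in> L1_loc" by (intro L1_loc_continuous primitive_of_continuous[OF G])
  have "(LINT x|lebesgue. deriv \<phi> x *\<^sub>R (f x - G x)) = 0" if "test_function \<phi>" for \<phi>
    using d[OF that] integral_deriv_primitive[OF G that] test_function_times_integrable[OF test_function_deriv[OF that]] f(1) Gl
    by (simp add: scaleR_diff_right)
  from du_Bois_Reymond[OF L1_loc_diff[OF f(1) Gl] this] obtain C where "AE x in lebesgue. f x - G x = C" by blast
  then have "AE x in lebesgue. f x = G x + C" by (auto simp: diff_eq_eq add.commute)
  moreover have "primitive_of g (\<lambda>x. G x + C)" using G by (simp add: primitive_of_def)
  ultimately show ?thesis using that by blast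
qed

text \<open>Makes the arbitrary choice in \<open>weak_deriv\<close> harmless for
  \<open>lame\<close>.\<close>

lemma weak_derivative_2_unique:
  assumes "has_weak_derivative 2 f g" "has_weak_derivative 2 f h"
  shows "AE x in lebesgue. g x = h x"
proof -
  have l: "g \<in> L1_loc" "h \<in> L1_loc" using assms by (auto simp: has_weak_derivative_def)
  have "(LINT x|lebesgue. \<phi> x *\<^sub>R (g x - h x)) = 0" if "test_function \<phi>" for \<phi>
    using assms that test_function_times_integrable[OF that] l
    by (simp add: has_weak_derivative_def scaleR_diff_right)
  from fundamental_lemma_calculus_of_variations[OF L1_loc_diff[OF l] this] show ?thesis by simp
qed

text \<open>The derivative of a test function is again a test function, so one of the two
  derivatives can be moved from \<phi> onto \<open>f\<close>.\<close>

lemma weak_derivative_1_2: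
  assumes "has_weak_derivative 1 f g" shows "has_weak_derivative 2 f h \<longleftrightarrow> has_weak_derivative 1 g h"
proof -
  have "(LINT x|lebesgue. (deriv ^^ 2) \<phi> x *\<^sub>R f x) = - (LINT x|lebesgue. deriv \<phi> x *\<^sub>R g x)" if "test_function \<phi>" for \<phi>
    using assms test_function_deriv[OF that] by (simp add: has_weak_derivative_def numeral_2_eq_2)
  then show ?thesis using assms by (simp add: has_weak_derivative_def minus_equation_iff) (metis minus_minus)
qed

subsection \<open>Absence of eigenvalues\<close>

lemma L2_add:
  assumes "f \<in> L2" "g \<in> L2" shows "(\<lambda>x. f x + g x) \<in> L2"
proof -
  have m: "f \<in> borel_measurable lebesgue" "g \<in> borel_measurable lebesgue"
    and i: "integrable lebesgue (\<lambda>x. (norm (f x))\<^sup>2)" "integrable lebesgue (\<lambda>x. (norm (g x))\<^sup>2)"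
    using assms by (auto simp: L2_def)
  have "(norm (f x + g x))\<^sup>2 \<le> 2 * (norm (f x))\<^sup>2 + 2 * (norm (g x))\<^sup>2" for x
  proof -
    have "(norm (f x + g x))\<^sup>2 \<le> (norm (f x) + norm (g x))\<^sup>2"
      by (intro power_mono norm_triangle_ineq) auto
    also have "\<dots> \<le> 2 * (norm (f x))\<^sup>2 + 2 * (norm (g x))\<^sup>2"
      using sum_squares_bound[of "norm (f x)" "norm (g x)"] by (simp add: power2_sum)
    finally show ?thesis .
  qed
  note le = this
  have "integrable lebesgue (\<lambda>x. (norm (f x + g x))\<^sup>2)"
  proof (rule Bochner_Integration.integrable_bound)
    show "integrable lebesgue (\<lambda>x. 2 * (norm (f x))\<^sup>2 + 2 * (norm (g x))\<^sup>2)" using i by simp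
    show "(\<lambda>x. (norm (f x + g x))\<^sup>2) \<in> borel_measurable lebesgue" using m by simp
    show "AE x in lebesgue. norm ((norm (f x + g x))\<^sup>2) \<le> norm (2 * (norm (f x))\<^sup>2 + 2 * (norm (g x))\<^sup>2)"
      by (intro AE_I2 order_trans[OF _ abs_ge_self[folded real_norm_def]]) (simp add: le)
  qed
  then show ?thesis using m by (auto simp: L2_def)
qed

lemma L2_cmult: "f \<in> L2 \<Longrightarrow> (\<lambda>x. c * f x) \<in> L2"
  by (auto simp: L2_def norm_mult power_mult_distrib)

lemma L2_cong_AE:
  assumes "f \<in> L2" "AE x in lebesgue. f x = g x" shows "g \<in> L2"
proof -
  have f: "f \<in> borel_measurable lebesgue" "integrable lebesgue (\<lambda>x. (norm (f x))\<^sup>2)"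
    using assms by (auto simp: L2_def)
  have "g \<in> borel_measurable lebesgue" by (rule borel_measurable_AE[OF f(1) assms(2)])
  moreover from this have "integrable lebesgue (\<lambda>x. (norm (g x))\<^sup>2)"
    using f assms(2) by (subst integrable_cong_AE[of _ _ "\<lambda>x. (norm (f x))\<^sup>2"]) auto
  ultimately show ?thesis by (simp add: L2_def)
qed

text \<open>Otherwise |f|^2 would be at least e^2 on intervals of arbitrary length. This replaces a
  limit at infinity, which a square integrable function need not have.\<close>

lemma L2_small_on_unbounded_set:
  assumes f: "f \<in> L2" and "e > 0" and S: "\<And>n::nat. \<exists>a. {a..a + real n} \<subseteq> S"
  shows "\<exists>x\<in>S. norm (f x) < e"
proof (rule ccontr)
  assume "\<not> ?thesis"
  then have ge: "norm (f x) \<ge> e" if "x \<in> S" for x using that by force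
  have i: "integrable lebesgue (\<lambda>x. (norm (f x))\<^sup>2)" using f by (simp add: L2_def)
  have "e\<^sup>2 * real n \<le> (LINT x|lebesgue. (norm (f x))\<^sup>2)" for n
  proof -
    obtain a where a: "{a..a + real n} \<subseteq> S" using S by blast
    have "e\<^sup>2 * real n = (LINT x|lebesgue. e\<^sup>2 * indicator {a..a + real n} x)" by simp
    also have "\<dots> \<le> (LINT x|lebesgue. (norm (f x))\<^sup>2)"
    proof (rule integral_mono[OF _ i])
      show "integrable lebesgue (\<lambda>x. e\<^sup>2 * indicator {a..a + real n} x)" by simp
      show "e\<^sup>2 * indicator {a..a + real n} x \<le> (norm (f x))\<^sup>2" for x
        using a ge[of x] \<open>e > 0\<close> by (auto simp: indicator_def intro!: power_mono)
    qed
    finally show ?thesis .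
  qed
  moreover obtain n :: nat where "(LINT x|lebesgue. (norm (f x))\<^sup>2) / e\<^sup>2 < n" using reals_Archimedean2 by blast
  ultimately show False using \<open>e > 0\<close> by (simp add: divide_less_eq mult.commute not_less[symmetric])
qed

lemma L2_small_left:
  assumes "f \<in> L2" "e > 0" shows "\<exists>x\<le>X. norm (f x) < e"
proof -
  have "\<exists>a. {a..a + real n} \<subseteq> {..X}" for n by (rule exI[of _ "X - real n"]) auto
  then show ?thesis using L2_small_on_unbounded_set[OF assms, of "{..X}"] by auto
qed

lemma L2_small_right:
  assumes "f \<in> L2" "e > 0" shows "\<exists>x\<ge>X. norm (f x) < e"
proof -
  have "\<exists>a. {a..a + real n} \<subseteq> {X..}" for n by (rule exI[of _ X]) auto
  then show ?thesis using L2_small_on_unbounded_set[OF assms, of "{X..}"] by auto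
qed

text \<open>The integrating factor exp(\<kappa> t) removes the term \<kappa> p: the derivative of
  exp(\<kappa> t) p is exp(\<kappa> t) f, whose modulus is at most B |f|.\<close>

lemma exp_primitive_increment_bound:
  assumes p: "primitive_of (\<lambda>t. f t - \<kappa> * p t) p" and f: "f \<in> L1_loc" and "x \<le> y"
    and B: "\<And>t. x \<le> t \<Longrightarrow> t \<le> y \<Longrightarrow> exp (Re \<kappa> * t) \<le> B"
  shows "norm (exp (\<kappa> * of_real y) * p y - exp (\<kappa> * of_real x) * p x) \<le> B * integral {x..y} (\<lambda>t. norm (f t))"
proof -
  define \<phi> where "\<phi> t = exp (\<kappa> * of_real t)" for t :: real
  have d: "(\<phi> has_vector_derivative \<kappa> * \<phi> t) (at t)" for t
  proof -
    have "((\<lambda>t. exp (\<kappa> * t)) has_field_derivative \<kappa> * \<phi> t) (at (of_real t))"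
      by (auto intro!: derivative_eq_intros simp: \<phi>_def)
    from has_vector_derivative_real_field[OF this] show ?thesis by (simp add: \<phi>_def[abs_def])
  qed
  have c: "continuous_on UNIV \<phi>" unfolding \<phi>_def by (intro continuous_intros)
  have eq: "\<kappa> * \<phi> t * p t + \<phi> t * (f t - \<kappa> * p t) = \<phi> t * f t" for t by (simp add: algebra_simps)
  have "primitive_of (\<lambda>t. \<phi> t * f t) (\<lambda>t. \<phi> t * p t)"
    using primitive_of_by_parts[OF p d continuous_on_mult[OF continuous_on_const c]] unfolding eq .
  from primitive_of_diff[OF this \<open>x \<le> y\<close>]
  have "norm (\<phi> y * p y - \<phi> x * p x) = norm (integral {x..y} (\<lambda>t. \<phi> t * f t))" by simp
  also have "\<dots> \<le> integral {x..y} (\<lambda>t. B * norm (f t))"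
  proof (rule Henstock_Kurzweil_Integration.integral_norm_bound_integral)
    show "(\<lambda>t. \<phi> t * f t) integrable_on {x..y}" by (intro L1_loc_integrable_on L1_loc_times_continuous f c)
    show "(\<lambda>t. B * norm (f t)) integrable_on {x..y}"
      using f by (intro integrable_on_mult_right) (simp add: L1_loc_iff absolutely_integrable_on_def)
    show "norm (\<phi> t * f t) \<le> B * norm (f t)" if "t \<in> {x..y}" for t
      using that B[of t] by (auto simp: \<phi>_def norm_mult intro!: mult_right_mono)
  qed
  finally show ?thesis by (simp add: \<phi>_def)
qed

text \<open>As Re \<kappa> \<ge> 0, the weight exp(Re \<kappa> t) is largest at the right endpoint
  y, so dividing by its value there leaves only weights at most 1.\<close>

lemma norm_primitive_le_left:
  assumes p: "primitive_of (\<lambda>t. f t - \<kappa> * p t) p" and f: "f \<in> L1_loc" and "x \<le> y" and "Re \<kappa> \<ge> 0"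
  shows "norm (p y) \<le> norm (p x) + integral {x..y} (\<lambda>t. norm (f t))"
proof -
  have le: "exp (Re \<kappa> * t) \<le> exp (Re \<kappa> * y)" if "t \<le> y" for t
    using that assms by (simp add: mult_left_mono)
  have "exp (Re \<kappa> * y) * norm (p y) \<le> norm (exp (\<kappa> * of_real x) * p x) + exp (Re \<kappa> * y) * integral {x..y} (\<lambda>t. norm (f t))"
    using exp_primitive_increment_bound[OF p f \<open>x \<le> y\<close> le]
      norm_triangle_sub[of "exp (\<kappa> * of_real y) * p y"
        "exp (\<kappa> * of_real x) * p x"]
    by (simp add: norm_mult)
  also have "\<dots> \<le> exp (Re \<kappa> * y) * (norm (p x) + integral {x..y} (\<lambda>t. norm (f t)))"
    using le[OF \<open>x \<le> y\<close>] by (simp add: norm_mult distrib_left mult_right_mono)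
  finally show ?thesis by simp
qed

text \<open>Mirror image of the preceding bound: with -\<kappa> for \<kappa> the weight is largest
  at the left endpoint x.\<close>

lemma norm_primitive_le_right:
  assumes p: "primitive_of (\<lambda>t. f t + \<kappa> * p t) p" and f: "f \<in> L1_loc" and "x \<le> y" and "Re \<kappa> \<ge> 0"
  shows "norm (p x) \<le> norm (p y) + integral {x..y} (\<lambda>t. norm (f t))"
proof -
  have p': "primitive_of (\<lambda>t. f t - (- \<kappa>) * p t) p" using p by simp
  have le: "exp (Re (- \<kappa>) * t) \<le> exp (Re (- \<kappa>) * x)" if "x \<le> t" for t
    using that assms by (simp add: mult_left_mono)
  have "exp (Re (- \<kappa>) * x) * norm (p x) \<le> norm (exp (- \<kappa> * of_real y) * p y) + exp (Re (- \<kappa>) * x) * integral {x..y} (\<lambda>t. norm (f t))"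
    using exp_primitive_increment_bound[OF p' f \<open>x \<le> y\<close> le]
      norm_triangle_sub[of "exp (- \<kappa> * of_real x) * p x"
        "exp (- \<kappa> * of_real y) * p y"]
    by (simp add: norm_mult norm_minus_commute)
  also have "\<dots> \<le> exp (Re (- \<kappa>) * x) * (norm (p y) + integral {x..y} (\<lambda>t. norm (f t)))"
    using le[OF \<open>x \<le> y\<close>] by (simp add: norm_mult distrib_left mult_right_mono)
  finally show ?thesis by (simp only: mult_le_cancel_left_pos exp_gt_zero)
qed

text \<open>\<open>F\<close> is constant, and square integrability makes it smaller than any e > 0
  somewhere.\<close>

lemma primitive_of_0_L2:
  assumes "primitive_of g F" "AE x in lebesgue. g x = 0" "F \<in> L2" shows "F x = 0"
proof -
  have p: "primitive_of (\<lambda>_. 0) F" using primitive_of_cong_AE[OF assms(1,2)] .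
  have "norm (F x) \<le> e" if e: "e > 0" for e
  proof -
    obtain y where "y \<le> x" "norm (F y) < e" using L2_small_left[OF assms(3) e] by blast
    then show ?thesis using primitive_of_diff[OF p, of y x] by simp
  qed
  then show ?thesis by (metis dense_ge norm_le_zero_iff)
qed

text \<open>The bounds for \<open>q\<close> and \<open>p\<close> use f to the right and to the left
  of x respectively, so together they cost its norm only once; this yields the sharp factor 2. For
  Re \<kappa> > 0 it is the bound given by the kernel exp(-\<kappa> |x - y|) / (2 \<kappa>), and it
  persists for Re \<kappa> = 0.\<close>

lemma resolvent_bound:
  assumes u: "u \<in> L2" and g: "g \<in> L2" and w: "has_weak_derivative 1 u g" "has_weak_derivative 1 g h"
    and h: "AE x in lebesgue. h x = \<kappa>\<^sup>2 * u x + f x" and \<kappa>: "Re \<kappa> \<ge> 0" and f: "integrable lebesgue f"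
  shows "AE x in lebesgue. 2 * norm \<kappa> * norm (u x) \<le> (LINT x|lebesgue. norm (f x))"
proof -
  \<comment> \<open>Continuous representatives of u and u', for which values at single points are
    meaningful.\<close>
  obtain U where U: "primitive_of g U" "AE x in lebesgue. u x = U x" using weak_derivative_primitive[OF w(1)] .
  obtain G where G: "primitive_of h G" "AE x in lebesgue. g x = G x" using weak_derivative_primitive[OF w(2)] .
  have UG: "primitive_of G U" by (rule primitive_of_cong_AE[OF U(1) G(2)])
  have "AE x in lebesgue. h x = \<kappa>\<^sup>2 * U x + f x" using h U(2) by eventually_elim simp
  then have GU: "primitive_of (\<lambda>x. \<kappa>\<^sup>2 * U x + f x) G" by (rule primitive_of_cong_AE[OF G(1)])
  have U2: "U \<in> L2" and G2: "G \<in> L2" using L2_cong_AE u g U(2) G(2) by blast+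
  have fn: "set_integrable lebesgue S f" if "S \<in> sets lebesgue" for S
    unfolding set_integrable_def by (rule integrable_mult_indicator[OF that f])
  then have fl: "f \<in> L1_loc" by (auto simp: L1_loc_iff)
  define p where "p x = G x + (- \<kappa>) * U x" for x
  define q where "q x = G x + \<kappa> * U x" for x
  have p: "primitive_of (\<lambda>t. f t - \<kappa> * p t) p"
    using primitive_of_lincomb[OF GU UG, of "- \<kappa>"] by (simp add: p_def[abs_def] algebra_simps power2_eq_square)
  have q: "primitive_of (\<lambda>t. f t + \<kappa> * q t) q"
    using primitive_of_lincomb[OF GU UG, of \<kappa>] by (simp add: q_def[abs_def] algebra_simps power2_eq_square)
  have p2: "p \<in> L2" and q2: "q \<in> L2"
    unfolding p_def[abs_def] q_def[abs_def] by (intro L2_add G2 L2_cmult U2)+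
  have "2 * norm \<kappa> * norm (U x) \<le> (LINT x|lebesgue. norm (f x))" for x
  proof (rule field_le_epsilon)
    fix e :: real assume "e > 0"
    obtain y where y: "y \<le> x" "norm (p y) < e / 2" using L2_small_left[OF p2, of "e / 2" x] \<open>e > 0\<close> by auto
    obtain z where z: "z \<ge> x" "norm (q z) < e / 2" using L2_small_right[OF q2, of "e / 2" x] \<open>e > 0\<close> by auto
    have ni: "(\<lambda>t. norm (f t)) integrable_on {y..z}" using fl by (simp add: L1_loc_iff absolutely_integrable_on_def)
    have "2 * norm \<kappa> * norm (U x) = norm (q x - p x)" by (simp add: p_def q_def norm_mult flip: mult_2 mult.assoc)
    also have "\<dots> \<le> norm (q x) + norm (p x)" by (rule norm_triangle_ineq4)
    also have "\<dots> \<le> (norm (q z) + integral {x..z} (\<lambda>t. norm (f t))) + (norm (p y) + integral {y..x} (\<lambda>t. norm (f t)))"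
      by (intro add_mono norm_primitive_le_right[OF q fl z(1) \<kappa>] norm_primitive_le_left[OF p fl y(1) \<kappa>])
    also have "\<dots> = norm (q z) + norm (p y) + integral {y..z} (\<lambda>t. norm (f t))"
      using Henstock_Kurzweil_Integration.integral_combine[OF y(1) z(1) ni] by simp
    also have "integral {y..z} (\<lambda>t. norm (f t)) = (LINT t:{y..z}|lebesgue. norm (f t))"
      by (intro set_lebesgue_integral_eq_integral(2)[symmetric] set_integrable_norm fn) auto
    also have "\<dots> \<le> (LINT t|lebesgue. norm (f t))"
      unfolding set_lebesgue_integral_def using set_integrable_norm[OF fn, of "{y..z}"] f
      by (intro integral_mono) (auto simp: set_integrable_def indicator_def)
    finally show "2 * norm \<kappa> * norm (U x) \<le> (LINT x|lebesgue. norm (f x)) + e" using y z by simp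
  qed
  then show ?thesis using U(2) by auto
qed

text \<open>Bounded by |a|^2 + |u|^2, where |a|^2 \<le> M |a|. This gives integrability of the
  source term before \<open>u\<close> is known to be bounded.\<close>

lemma integrable_mult_L1_Linfty_L2:
  assumes a: "a \<in> L1 \<inter> Linfty" and u: "u \<in> L2" shows "integrable lebesgue (\<lambda>x. a x * u x)"
proof -
  obtain M where M: "AE x in lebesgue. norm (a x) \<le> M" using a by (auto simp: Linfty_def)
  have i: "integrable lebesgue a" "integrable lebesgue (\<lambda>x. (norm (u x))\<^sup>2)"
    and [measurable]: "u \<in> borel_measurable lebesgue" "a \<in> borel_measurable lebesgue"
    using a u by (auto simp: L1_def L2_def)
  show ?thesis
  proof (rule Bochner_Integration.integrable_bound)
    show "integrable lebesgue (\<lambda>x. M * norm (a x) + (norm (u x))\<^sup>2)" using i by simp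
    show "AE x in lebesgue. norm (a x * u x) \<le> norm (M * norm (a x) + (norm (u x))\<^sup>2)" using M
    proof eventually_elim
      case (elim x)
      have "2 * (norm (a x) * norm (u x)) \<le> (norm (a x))\<^sup>2 + (norm (u x))\<^sup>2"
        using sum_squares_bound[of "norm (a x)" "norm (u x)"] by simp
      moreover have "(norm (a x))\<^sup>2 \<le> M * norm (a x)" using elim by (simp add: power2_eq_square mult_right_mono)
      moreover have "0 \<le> norm (a x) * norm (u x)" by simp
      ultimately have "norm (a x) * norm (u x) \<le> M * norm (a x) + (norm (u x))\<^sup>2" by linarith
      then show ?case by (simp add: norm_mult)
    qed
  qed measurable
qed

lemma eigenfunction_trivial:
  assumes c: "c > 0" and a: "a \<in> L1 \<inter> Linfty" "L1_norm a < 2 * c"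
    and u: "u \<in> L2" and g: "g \<in> L2" and w: "has_weak_derivative 1 u g" "has_weak_derivative 1 g h"
    and eq: "AE x in lebesgue. of_real (c\<^sup>2) * h x = z * (z + a x) * u x"
  shows "AE x in lebesgue. u x = 0"
proof (cases "z = 0")
  case True
  obtain U where U: "primitive_of g U" "AE x in lebesgue. u x = U x" using weak_derivative_primitive[OF w(1)] .
  obtain G where G: "primitive_of h G" "AE x in lebesgue. g x = G x" using weak_derivative_primitive[OF w(2)] .
  \<comment> \<open>For z = 0 the equation says u'' = 0: first u', then u is constant and square
    integrable, hence zero.\<close>
  have "AE x in lebesgue. h x = 0" using eq True c by simp
  then have "G x = 0" for x by (rule primitive_of_0_L2[OF G(1) _ L2_cong_AE[OF g G(2)]])
  then have "AE x in lebesgue. g x = 0" using G(2) by simp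
  then have "U x = 0" for x by (rule primitive_of_0_L2[OF U(1) _ L2_cong_AE[OF u U(2)]])
  then show ?thesis using U(2) by simp
next
  case False
  define \<kappa> where "\<kappa> = (if Re z \<ge> 0 then z / of_real c else - z / of_real c)"
  have \<kappa>: "Re \<kappa> \<ge> 0" "\<kappa>\<^sup>2 = z\<^sup>2 / of_real (c\<^sup>2)" "norm \<kappa> = norm z / c"
    using c by (auto simp: \<kappa>_def power_divide norm_divide Re_divide_of_real divide_le_0_iff)
  define f where "f x = z / of_real (c\<^sup>2) * (a x * u x)" for x
  have f: "integrable lebesgue f" unfolding f_def[abs_def]
    by (intro integrable_mult_right integrable_mult_L1_Linfty_L2 a u)
  have "AE x in lebesgue. h x = \<kappa>\<^sup>2 * u x + f x" using eq
  proof eventually_elim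
    case (elim x)
    then have "h x = z * (z + a x) * u x / of_real (c\<^sup>2)" using c by (simp add: field_simps)
    then show ?case unfolding \<kappa> f_def by (simp add: algebra_simps power2_eq_square add_divide_distrib)
  qed
  note bound = resolvent_bound[OF u g w this \<kappa>(1) f]
  define N where "N = (LINT x|lebesgue. norm (f x))"
  \<comment> \<open>The bound N / (2 |\<kappa>|) supplied by \<open>resolvent_bound\<close>, with
    |\<kappa>| = |z| / c.\<close>
  define B where "B = N * c / (2 * norm z)"
  have ub: "AE x in lebesgue. norm (u x) \<le> B" using bound
  proof eventually_elim
    case (elim x) then show ?case using c False by (simp add: \<kappa> B_def N_def[symmetric] field_simps)
  qed
  have "N \<le> (LINT x|lebesgue. norm z / c\<^sup>2 * B * norm (a x))" unfolding N_def
  proof (rule integral_mono_AE)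
    show "integrable lebesgue (\<lambda>x. norm (f x))" using f by simp
    show "integrable lebesgue (\<lambda>x. norm z / c\<^sup>2 * B * norm (a x))" using a by (simp add: L1_def)
    show "AE x in lebesgue. norm (f x) \<le> norm z / c\<^sup>2 * B * norm (a x)" using ub
    proof eventually_elim
      case (elim x)
      then have "norm z / c\<^sup>2 * norm (a x) * norm (u x) \<le> norm z / c\<^sup>2 * norm (a x) * B" by (intro mult_left_mono) auto
      then show ?case by (simp add: f_def norm_mult norm_divide norm_power mult_ac)
    qed
  qed
  \<comment> \<open>\<open>B\<close> is proportional to \<open>N\<close>, so the estimate closes on
    the finite number \<open>N\<close> itself, with a factor below 1.\<close>
  also have "\<dots> = N * (L1_norm a / (2 * c))"
    using False c by (simp add: L1_norm_def B_def field_simps power2_eq_square)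
  finally have "N * (1 - L1_norm a / (2 * c)) \<le> 0" by (simp add: right_diff_distrib)
  moreover have "1 - L1_norm a / (2 * c) > 0" using a(2) c by (simp add: field_simps)
  ultimately have "N \<le> 0" by (simp add: mult_le_0_iff)
  then have "B \<le> 0" using c by (simp add: B_def divide_nonpos_nonneg mult_nonpos_nonneg)
  show ?thesis using ub
  proof eventually_elim
    case (elim x) with \<open>B \<le> 0\<close> show ?case by (metis norm_le_zero_iff order_trans)
  qed
qed

lemma point_spectrum_empty:
  assumes k: "lam + 2 * mu > 0" and a: "a \<in> L1 \<inter> Linfty" "L1_norm a < 2 * sqrt (lam + 2 * mu)"
  shows "point_spectrum lam mu a = {}"
proof (rule ccontr)
  assume "point_spectrum lam mu a \<noteq> {}"
  then obtain z u v where uv: "u \<in> sobolev_H 2" "v \<in> homogeneous_H1"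
    and nz: "\<not> eq_ae (u, v) (\<lambda>x. 0, \<lambda>x. 0)"
    and v: "AE x in lebesgue. v x = z * u x"
    and eq: "AE x in lebesgue. of_real (lam + 2 * mu) * weak_deriv 2 u x - a x * v x = z * v x"
    by (auto simp: point_spectrum_def dew_domain_def dew_op_def eq_ae_def lame_def)
  obtain g where g: "g \<in> L2" "has_weak_derivative 1 u g" using uv(1) by (auto simp: sobolev_H_def dest: spec[of _ 1])
  \<comment> \<open>Existence of some second weak derivative ensures that the choice made by
    \<open>weak_deriv\<close> is one.\<close>
  have "\<exists>h. has_weak_derivative 2 u h" using uv(1) by (auto simp: sobolev_H_def dest: spec[of _ 2])
  then have "has_weak_derivative 2 u (weak_deriv 2 u)" unfolding weak_deriv_def by (rule someI_ex)
  then have h: "has_weak_derivative 1 g (weak_deriv 2 u)" using weak_derivative_1_2[OF g(2)] by simp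
  \<comment> \<open>Inserting v = z u into the second component leaves a single second-order
    equation for u.\<close>
  have "AE x in lebesgue. of_real ((sqrt (lam + 2 * mu))\<^sup>2) * weak_deriv 2 u x = z * (z + a x) * u x"
    using eq v
  proof eventually_elim
    case (elim x)
    then show ?case using k by (simp add: algebra_simps)
  qed
  from eigenfunction_trivial[OF _ a _ g(1) g(2) h this] uv(1) k
  have "AE x in lebesgue. u x = 0" by (auto simp: sobolev_H_def)
  then have "eq_ae (u, v) (\<lambda>x. 0, \<lambda>x. 0)" using v unfolding eq_ae_def by (auto elim: AE_mp)
  with nz show False by blast
qed

subsection \<open>Optimality\<close>

text \<open>The integrand is the derivative of tanh(\<kappa> x) / \<kappa>, with limits 1/\<kappa>
  and -1/\<kappa>; being nonnegative, it gets integrability and value from the fundamental theorem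
  at once. It serves both for the norm of the damping and as a majorant in
  \<open>sech_power_L2\<close>.\<close>

lemma integral_sech_squared:
  fixes \<kappa> :: real
  assumes "\<kappa> > 0"
  shows "integrable lebesgue (\<lambda>x. 1 - (tanh (\<kappa> * x))\<^sup>2)"
    and "(LINT x|lebesgue. 1 - (tanh (\<kappa> * x))\<^sup>2) = 2 / \<kappa>"
proof -
  let ?f = "\<lambda>x. 1 - (tanh (\<kappa> * x))\<^sup>2" and ?F = "\<lambda>x. tanh (\<kappa> * x) / \<kappa>"
  have top: "filterlim (\<lambda>x. \<kappa> * x) at_top at_top" and bot: "filterlim (\<lambda>x. \<kappa> * x) at_bot at_bot"
    using assms
    by (auto intro!: filterlim_tendsto_pos_mult_at_top[OF tendsto_const]
        filterlim_tendsto_pos_mult_at_bot[OF tendsto_const]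
        filterlim_ident)
  have T: "(?F \<longlongrightarrow> 1 / \<kappa>) at_top" "(?F \<longlongrightarrow> - 1 / \<kappa>) at_bot"
    using assms
    by (intro tendsto_divide tendsto_const filterlim_compose[OF tanh_real_at_top top]
        filterlim_compose[OF tanh_real_at_bot bot]; simp)+
  have d: "(?F has_real_derivative ?f x) (at x)" for x
    using assms by (auto intro!: derivative_eq_intros simp: field_simps)
  have c: "isCont ?f x" for x by (intro continuous_intros) auto
  have nn: "0 \<le> ?f x" for x using tanh_real_bounds[of "\<kappa> * x"] by (simp add: abs_square_le_1 abs_le_iff)
  have T': "((?F \<circ> real_of_ereal) \<longlongrightarrow> - 1 / \<kappa>) (at_right (-\<infinity>))" "((?F \<circ> real_of_ereal) \<longlongrightarrow> 1 / \<kappa>) (at_left \<infinity>)"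
    unfolding ereal_tendsto_simps by (fact T)+
  note 1 = interval_integral_FTC_nonneg[of "-\<infinity>" \<infinity>, OF _ d c _ T', simplified nn, simplified]
  have i: "integrable lborel ?f" and v: "(LINT x|lborel. ?f x) = 2 / \<kappa>"
    using 1 by (simp_all add: set_integrable_def interval_lebesgue_integral_def set_lebesgue_integral_def)
  have m: "?f \<in> borel_measurable lborel" using i by auto
  show "integrable lebesgue ?f" using i integrable_completion[OF m] by simp
  show "(LINT x|lebesgue. ?f x) = 2 / \<kappa>" using v integral_completion[OF m] by simp
qed

section \<open>Criteria for membership in the domain and in the point spectrum\<close>

lemma primitive_of_C1:
  assumes "\<And>x. (F has_vector_derivative f x) (at x)" "continuous_on UNIV f"
  shows "primitive_of f F"
proof -
  have "integral {x..y} f = F y - F x" if "x \<le> y" for x y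
    using assms(1) that by (intro integral_unique fundamental_theorem_of_calculus) (auto intro: has_vector_derivative_at_within)
  then show ?thesis using L1_loc_continuous[OF assms(2)] by (simp add: primitive_of_def)
qed

lemma L2_bounded_mult:
  assumes u: "u \<in> L2" and c: "continuous_on UNIV b" and B: "\<And>x. norm (b x) \<le> B"
  shows "(\<lambda>x. b x * u x) \<in> L2"
proof -
  have m: "b \<in> borel_measurable lebesgue" using L1_loc_measurable[OF L1_loc_continuous[OF c]] .
  have u': "u \<in> borel_measurable lebesgue" "integrable lebesgue (\<lambda>x. (norm (u x))\<^sup>2)"
    using u by (auto simp: L2_def)
  have le: "(norm (b x * u x))\<^sup>2 \<le> B\<^sup>2 * (norm (u x))\<^sup>2" for x
    using B[of x] by (simp add: norm_mult power_mult_distrib mult_right_mono power_mono)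
  have "integrable lebesgue (\<lambda>x. (norm (b x * u x))\<^sup>2)"
  proof (rule Bochner_Integration.integrable_bound)
    show "integrable lebesgue (\<lambda>x. B\<^sup>2 * (norm (u x))\<^sup>2)" using u' by simp
    show "(\<lambda>x. (norm (b x * u x))\<^sup>2) \<in> borel_measurable lebesgue" using m u' by simp
    show "AE x in lebesgue. norm ((norm (b x * u x))\<^sup>2) \<le> norm (B\<^sup>2 * (norm (u x))\<^sup>2)"
      using le by (intro AE_I2) simp
  qed
  then show ?thesis using m u' by (simp add: L2_def)
qed

lemma sobolev_H_2I:
  assumes u: "u \<in> L2" "g \<in> L2" "h \<in> L2" and p: "primitive_of g u" "primitive_of h g"
  shows "u \<in> sobolev_H 2" "AE x in lebesgue. weak_deriv 2 u x = h x"
proof -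
  have 1: "has_weak_derivative 1 u g" using p has_weak_derivative_primitive by blast
  have 2: "has_weak_derivative 2 u h"
    using weak_derivative_1_2[OF 1] has_weak_derivative_primitive[OF p(2)] by simp
  have "has_weak_derivative 0 u u" using 1 by (simp add: has_weak_derivative_def)
  then have "\<exists>g\<in>L2. has_weak_derivative j u g" if "j \<le> 2" for j
    using that u 1 2 by (cases "j = 0"; cases "j = 1") (auto simp: le_Suc_eq numeral_2_eq_2)
  then show "u \<in> sobolev_H 2" using u(1) by (simp add: sobolev_H_def)
  show "AE x in lebesgue. weak_deriv 2 u x = h x"
    unfolding weak_deriv_def by (rule weak_derivative_2_unique[OF someI[of _ h] 2]) (rule 2)
qed

lemma not_AE_eq_0: "(\<And>x. u x \<noteq> 0) \<Longrightarrow> \<not> (AE x in lebesgue. u x = (0::complex))" for u :: "real \<Rightarrow> complex"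
proof
  assume "\<And>x. u x \<noteq> 0" "AE x in lebesgue. u x = 0"
  then obtain N :: "real set" where "negligible N" "UNIV \<subseteq> N"
    by (auto simp: eventually_ae_filter negligible_iff_null_sets)
  then show False using non_negligible_UNIV by (metis top.extremum_unique)
qed

text \<open>The first component of the eigenvalue equation forces v = z u, whose weak derivative z g
  is square integrable.\<close>

lemma point_spectrumI:
  assumes "u \<in> sobolev_H 2" "has_weak_derivative 1 u g" "g \<in> L2" "\<And>x. u x \<noteq> 0"
    and "AE x in lebesgue. of_real (lam + 2 * mu) * weak_deriv 2 u x = z * (z + a x) * u x"
  shows "z \<in> point_spectrum lam mu a"
proof -
  have "(\<lambda>x. z * u x) \<in> homogeneous_H1"
  proof -
    have "has_weak_derivative 1 (\<lambda>x. z * u x) (\<lambda>x. z * g x)"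
      using assms(2) L1_loc_cmult by (simp add: has_weak_derivative_def flip: mult_scaleR_right)
    then show ?thesis using L2_cmult[OF assms(3)] by (auto simp: homogeneous_H1_def has_weak_derivative_def)
  qed
  moreover have "AE x in lebesgue. of_real (lam + 2 * mu) * weak_deriv 2 u x - a x * (z * u x) = z * (z * u x)"
    using assms(5) by eventually_elim (simp add: algebra_simps)
  ultimately show ?thesis using assms(1) not_AE_eq_0[OF assms(4)]
    unfolding point_spectrum_def dew_domain_def dew_op_def eq_ae_def lame_def
    by (intro CollectI bexI[of _ "(u, \<lambda>x. z * u x)"]) auto
qed

text \<open>The function \<open>cosh powr (- \<kappa>)\<close>, in a form that is convenient to differentiate.\<close>
definition sech_power :: "real \<Rightarrow> real \<Rightarrow> real" where
  "sech_power \<kappa> x = exp (- (\<kappa> * ln (cosh x)))"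

lemma sech_power_DERIV: "(sech_power \<kappa> has_real_derivative - \<kappa> * tanh x * sech_power \<kappa> x) (at x)"
  unfolding sech_power_def by (auto intro!: derivative_eq_intros simp: tanh_def)

text \<open>The product rule gives the factor \<kappa>^2 tanh^2 - \<kappa> (1 - tanh^2); it is
  rewritten as a constant minus a multiple of sech^2 to match z (z + a) / c^2.\<close>

lemma sech_power_DERIV_2:
  "((\<lambda>x. - \<kappa> * tanh x * sech_power \<kappa> x) has_real_derivative
    (\<kappa>\<^sup>2 - (\<kappa>\<^sup>2 + \<kappa>) * (1 - (tanh x)\<^sup>2)) * sech_power \<kappa> x) (at x)"
  by (auto intro!: derivative_eq_intros sech_power_DERIV simp: algebra_simps power2_eq_square)

lemma continuous_on_sech_power: "continuous_on S (sech_power \<kappa>)"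
  by (meson sech_power_DERIV DERIV_isCont continuous_at_imp_continuous_on)

text \<open>From cosh x \<ge> exp |x| / 2 the function is at most 2^\<kappa> exp(-\<kappa> |x|), and
  exp(-\<kappa> |x|) \<le> sech(\<kappa> x). Its square is therefore dominated by a multiple of
  sech^2(\<kappa> x).\<close>

lemma sech_power_L2:
  assumes "\<kappa> > 0" shows "(\<lambda>x. of_real (sech_power \<kappa> x)) \<in> L2"
proof -
  have le: "(sech_power \<kappa> x)\<^sup>2 \<le> (exp (\<kappa> * ln 2))\<^sup>2 * (1 - (tanh (\<kappa> * x))\<^sup>2)" for x
  proof -
    have "exp \<bar>x\<bar> / 2 \<le> cosh x" by (cases "x \<ge> 0") (auto simp: cosh_def)
    then have "ln (exp \<bar>x\<bar> / 2) \<le> ln (cosh x)" by (intro ln_mono) auto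
    then have "\<bar>x\<bar> - ln 2 \<le> ln (cosh x)" by (simp add: ln_div)
    then have "\<kappa> * (\<bar>x\<bar> - ln 2) \<le> \<kappa> * ln (cosh x)" using assms by (intro mult_left_mono) auto
    then have "sech_power \<kappa> x \<le> exp (\<kappa> * ln 2 - \<bar>\<kappa> * x\<bar>)"
      using assms by (simp add: sech_power_def right_diff_distrib abs_mult)
    also have "\<dots> = exp (\<kappa> * ln 2) * (1 / exp \<bar>\<kappa> * x\<bar>)" by (simp add: exp_diff)
    also have "\<dots> \<le> exp (\<kappa> * ln 2) * (1 / cosh (\<kappa> * x))"
    proof -
      have "cosh (\<kappa> * x) \<le> exp \<bar>\<kappa> * x\<bar>" by (cases "\<kappa> * x \<ge> 0") (auto simp: cosh_def)
      then show ?thesis by (intro mult_left_mono divide_left_mono) auto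
    qed
    finally have "(sech_power \<kappa> x)\<^sup>2 \<le> (exp (\<kappa> * ln 2) * (1 / cosh (\<kappa> * x)))\<^sup>2"
      by (intro power_mono) (auto simp: sech_power_def)
    also have "\<dots> = (exp (\<kappa> * ln 2))\<^sup>2 * (1 - (tanh (\<kappa> * x))\<^sup>2)"
    proof -
      have "(1 / cosh (\<kappa> * x))\<^sup>2 = 1 - (tanh (\<kappa> * x))\<^sup>2"
        using diff_divide_distrib[of "(cosh (\<kappa> * x))\<^sup>2" "(sinh (\<kappa> * x))\<^sup>2" "(cosh (\<kappa> * x))\<^sup>2"]
        by (simp add: tanh_def power_divide hyperbolic_pythagoras)
      then show ?thesis by (simp only: power_mult_distrib)
    qed
    finally show ?thesis .
  qed
  have m: "(\<lambda>x. of_real (sech_power \<kappa> x) :: complex) \<in> borel_measurable lebesgue"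
    by (intro L1_loc_measurable L1_loc_continuous continuous_intros continuous_on_sech_power)
  have "integrable lebesgue (\<lambda>x. (norm (of_real (sech_power \<kappa> x) :: complex))\<^sup>2)"
  proof (rule Bochner_Integration.integrable_bound)
    show "integrable lebesgue (\<lambda>x. (exp (\<kappa> * ln 2))\<^sup>2 * (1 - (tanh (\<kappa> * x))\<^sup>2))"
      using integral_sech_squared(1)[OF assms] by (intro integrable_mult_right)
    show "(\<lambda>x. (norm (of_real (sech_power \<kappa> x) :: complex))\<^sup>2) \<in> borel_measurable lebesgue"
      by (intro borel_measurable_power measurable_compose[OF m borel_measurable_norm])
    show "AE x in lebesgue. norm ((norm (of_real (sech_power \<kappa> x) :: complex))\<^sup>2)
        \<le> norm ((exp (\<kappa> * ln 2))\<^sup>2 * (1 - (tanh (\<kappa> * x))\<^sup>2))"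
      by (intro AE_I2)
        (simp only: norm_of_real real_norm_def power2_abs abs_power2 order_trans[OF le abs_ge_self])
  qed
  with m show ?thesis by (simp add: L2_def)
qed

lemma point_spectrum_sech:
  fixes c z lam mu :: real
  assumes "c > 0" "z > 0" and k: "lam + 2 * mu = c\<^sup>2"
  defines "a \<equiv> \<lambda>x. of_real (- (z + c) * (1 - (tanh x)\<^sup>2)) :: complex"
  shows "a \<in> L1 \<inter> Linfty" "L1_norm a = 2 * c + 2 * z" "of_real z \<in> point_spectrum lam mu a"
proof -
  have t: "(tanh x)\<^sup>2 \<le> 1" for x :: real using tanh_real_bounds[of x] by (simp add: abs_square_le_1 abs_le_iff)
  have n: "norm (a x) = (z + c) * (1 - (tanh x)\<^sup>2)" for x
    using assms t[of x] unfolding a_def norm_of_real by (simp add: abs_mult)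
  have "integrable lebesgue (\<lambda>x. of_real (- (z + c) * (1 - (tanh x)\<^sup>2)) :: complex)"
    using integral_sech_squared(1)[of 1] by (intro integrable_of_real integrable_mult_right) simp
  then have i: "integrable lebesgue a" by (simp only: a_def)
  moreover have "norm (a x) \<le> z + c" for x unfolding n using assms by (intro mult_left_le) auto
  ultimately show "a \<in> L1 \<inter> Linfty" by (auto simp: L1_def Linfty_def)
  show "L1_norm a = 2 * c + 2 * z"
    unfolding L1_norm_def n using integral_sech_squared(2)[of 1] by simp
  \<comment> \<open>This decay rate matches the constant terms, c^2 \<kappa>^2 = z^2; the sech^2
    terms then have coefficient c^2 (\<kappa>^2 + \<kappa>) = z (z + c), which dictates the
    amplitude z + c of the damping.\<close>
  define \<kappa> where "\<kappa> = z / c"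
  have \<kappa>: "\<kappa> > 0" "c\<^sup>2 * \<kappa>\<^sup>2 = z\<^sup>2" "c\<^sup>2 * (\<kappa>\<^sup>2 + \<kappa>) = z * (z + c)"
    using assms by (auto simp: \<kappa>_def field_simps power2_eq_square)
  define u where "u x = (of_real (sech_power \<kappa> x) :: complex)" for x
  define g where "g x = of_real (- \<kappa> * tanh x) * u x" for x
  define b where "b x = \<kappa>\<^sup>2 - (\<kappa>\<^sup>2 + \<kappa>) * (1 - (tanh x)\<^sup>2)" for x
  define h where "h x = of_real (b x) * u x" for x
  have c: "continuous_on UNIV (sech_power \<kappa>)" "continuous_on UNIV (\<lambda>x. - \<kappa> * tanh x)" "continuous_on UNIV b"
    unfolding b_def[abs_def] by (intro continuous_on_sech_power continuous_intros; simp)+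
  have u: "u \<in> L2" unfolding u_def[abs_def] by (rule sech_power_L2[OF \<kappa>(1)])
  have g: "g \<in> L2" unfolding g_def[abs_def]
  proof (intro L2_bounded_mult[OF u] continuous_intros c)
    show "norm (of_real (- \<kappa> * tanh x) :: complex) \<le> \<kappa>" for x
      using tanh_real_bounds[of x] \<kappa>(1) unfolding norm_of_real by (auto simp: abs_mult intro!: mult_left_le)
  qed auto
  have h: "h \<in> L2" unfolding h_def[abs_def]
  proof (intro L2_bounded_mult[OF u] continuous_intros c)
    fix x
    have "(\<kappa>\<^sup>2 + \<kappa>) * (1 - (tanh x)\<^sup>2) \<le> \<kappa>\<^sup>2 + \<kappa>" "0 \<le> (\<kappa>\<^sup>2 + \<kappa>) * (1 - (tanh x)\<^sup>2)" "0 \<le> \<kappa>\<^sup>2"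
      using \<kappa>(1) t[of x] by (auto intro!: mult_left_le)
    then show "norm (of_real (b x) :: complex) \<le> \<kappa>\<^sup>2 + \<kappa>"
      using \<kappa>(1) unfolding norm_of_real b_def by (intro abs_leI; linarith)
  qed
  have cu: "continuous_on UNIV u" unfolding u_def[abs_def] by (intro continuous_intros c)
  have ug: "primitive_of g u"
  proof (rule primitive_of_C1)
    show "(u has_vector_derivative g x) (at x)" for x
      using has_vector_derivative_of_real[OF sech_power_DERIV, of \<kappa> x]
      by (simp add: u_def[abs_def] g_def)
    show "continuous_on UNIV g" unfolding g_def[abs_def] by (intro continuous_intros c cu)
  qed
  have gh: "primitive_of h g"
  proof (rule primitive_of_C1)
    show "(g has_vector_derivative h x) (at x)" for x
      using has_vector_derivative_of_real[OF sech_power_DERIV_2, of \<kappa> x]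
      by (simp add: u_def[abs_def] g_def[abs_def] h_def b_def)
    show "continuous_on UNIV h" unfolding h_def[abs_def] by (intro continuous_intros c cu)
  qed
  note H = sobolev_H_2I[OF u g h ug gh]
  have ev: "of_real (lam + 2 * mu) * h x = of_real z * (of_real z + a x) * u x" for x
  proof -
    have "c\<^sup>2 * b x = c\<^sup>2 * \<kappa>\<^sup>2 - c\<^sup>2 * (\<kappa>\<^sup>2 + \<kappa>) * (1 - (tanh x)\<^sup>2)" by (simp add: b_def algebra_simps)
    also have "\<dots> = z * (z + (- (z + c) * (1 - (tanh x)\<^sup>2)))" unfolding \<kappa> by (simp add: algebra_simps power2_eq_square)
    finally have "of_real (c\<^sup>2) * of_real (b x) = of_real z * (of_real z + a x)"
      unfolding a_def by (simp only: flip: of_real_mult of_real_add)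
    then show ?thesis unfolding k h_def by (simp only: mult.assoc[symmetric])
  qed
  show "of_real z \<in> point_spectrum lam mu a"
  proof (rule point_spectrumI[OF H(1) has_weak_derivative_primitive[OF ug] g])
    show "u x \<noteq> 0" for x by (simp add: u_def sech_power_def)
    show "AE x in lebesgue. of_real (lam + 2 * mu) * weak_deriv 2 u x = of_real z * (of_real z + a x) * u x"
      using H(2) by eventually_elim (simp only: ev)
  qed
qed

theorem theorem1p7:
  fixes lam mu :: real
  assumes "mu > 0" and "lam + mu \<ge> 0"
  shows "(\<forall>a. a \<in> L1 \<inter> Linfty \<and> L1_norm a < 2 * sqrt (lam + 2 * mu) \<longrightarrow>
            point_spectrum lam mu a = {}) \<and>
         (\<forall>C. C > 2 * sqrt (lam + 2 * mu) \<longrightarrow>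
            (\<exists>a. a \<in> L1 \<inter> Linfty \<and> L1_norm a < C \<and> point_spectrum lam mu a \<noteq> {}))"
proof (intro conjI allI impI)
  have k: "lam + 2 * mu > 0" using assms by linarith
  then show "point_spectrum lam mu a = {}" if "a \<in> L1 \<inter> Linfty \<and> L1_norm a < 2 * sqrt (lam + 2 * mu)" for a
    using point_spectrum_empty that by blast
  fix C assume C: "C > 2 * sqrt (lam + 2 * mu)"
  define c where "c = sqrt (lam + 2 * mu)"
  \<comment> \<open>With this choice 2 c + 2 z is the midpoint of 2 c and C.\<close>
  define z where "z = (C - 2 * c) / 4"
  have "c > 0" "z > 0" "lam + 2 * mu = c\<^sup>2" "2 * c + 2 * z < C"
    using k C by (auto simp: c_def z_def field_simps)
  with point_spectrum_sech[of c z lam mu]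
  show "\<exists>a. a \<in> L1 \<inter> Linfty \<and> L1_norm a < C \<and> point_spectrum lam mu a \<noteq> {}" by (metis empty_iff)
qed

end
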